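(* Let $L,h,\alpha,\beta>0$, $\Omega=(-L,L)$, and let $f(x)=0$ for $x\in(-L,0]$ and $f(x)=h$ for $x\in(0,L)$. Put $k=\frac1{\sqrt\beta}$. Consider the solution pair $(w,u)$, with $w\neq0$, of $$\min_{u\in \mathrm{BV}(\Omega),\ w\in L^2(\Omega)}\ \frac12\|f-u\|_{L^2(\Omega)}^2+\alpha\|Du-w\|_{\mathcal M}+\frac{\beta}{2}\|w\|_{L^2(\Omega)}^2 ,$$ and the associated function $\phi\in H^1_0(\Omega)$ with $\phi'=u-f$, $\phi\in\alpha\,\mathrm{Sgn}(Du-w)$, $\phi=\beta w$. (i) For solutions that are continuous (for which one requires $u(0)=\frac h2$, $\phi(-L)=0$, $u'(-L)=0$ and $\phi(0)<\alpha$): $$u(x)=\begin{cases}c_1e^{kx}+c_2e^{-kx}&\text{if }x\in(-L,0],\\ h-c_1e^{-kx}-c_2e^{kx}&\text{if }x\in(0,L)\end{cases}\quad\Longleftrightarrow\quad \frac{\tanh(kL)}{k}<\frac{2\alpha}{h},$$ where $c_1=c_2e^{2kL}$ and $c_2=\dfrac{h}{2(e^{2kL}+1)}$. (ii) For solutions that preserve the discontinuity at $x=0$ (for which one requires $\phi(-L)=0$, $u'(-L)=0$, $u(0)<\frac h2$ and $\phi(0)=\alpha$): $$u(x)=\begin{cases}c_1e^{kx}+c_2e^{-kx}&\text{if }x\in(-L,0],\\ h-c_1e^{-kx}-c_2e^{kx}&\text{if }x\in(0,L)\end{cases}\quad\Longleftrightarrow\quad \frac{\tanh(kL)}{k}>\frac{2\alpha}{h},$$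 where $c_1=c_2e^{2kL}$ and $c_2=\dfrac{\alpha k}{e^{2kL}-1}$. The conditions on $\alpha$ and $\beta$ in (i) and (ii) are supplementary, and thus only these two types of solutions can occur.
   Context: $Du$ is the distributional derivative of $u\in \mathrm{BV}(\Omega)$ (a finite Radon measure), $w$ is identified with the measure $w\,\mathcal L^1$, and $\|\mu\|_{\mathcal M}=|\mu|(\Omega)$ is the Radon (total variation) norm. For a finite Radon measure $\mu$ with polar decomposition $\mu=\mathrm{sgn}(\mu)|\mu|$, $\mathrm{Sgn}(\mu)$ is the set of $v\in L^\infty(\Omega)\cap L^\infty(\Omega,|\mu|)$ with $\|v\|_\infty\le1$ and $v=\mathrm{sgn}(\mu)$ $|\mu|$-a.e. A pair $(w,u)$ solves the problem if and only if a function $\phi$ as in the claim exists. The solution is symmetric in the sense that $u(x)+u(-x)=h$; $u(0)$ is the value at $0$ of the expression for $u$ on $(-L,0]$.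
   Formalization: If tanh(kL)/k = 2α/h, neither condition holds and the solution is continuous with φ(0)=α, so it is of neither type; each equivalence reads "type and formula ⟺ condition", exactly one type occurs off equality, and at equality u is continuous with formula (i). *)

theory Defs
  imports "HOL-Analysis.Analysis"
begin

text \<open>Functions on an open set \<open>\<Omega>\<close> are total functions on \<open>real\<close>, of which only the restriction to
  \<open>\<Omega>\<close> matters. Elements of \<open>L\<^sup>2\<close> and BV are concrete functions; statements about them are
  made almost everywhere with respect to \<^term>\<open>lebesgue_on \<Omega>\<close>.\<close>

definition L2 :: "real set \<Rightarrow> (real \<Rightarrow> real) set" where
  "L2 \<Omega> = {g. g \<in> borel_measurable (lebesgue_on \<Omega>) \<and> integrable (lebesgue_on \<Omega>) (\<lambda>x. (g x)\<^sup>2)}"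

definition L2_norm :: "real set \<Rightarrow> (real \<Rightarrow> real) \<Rightarrow> real" where
  "L2_norm \<Omega> g = sqrt (LINT x|lebesgue_on \<Omega>. (g x)\<^sup>2)"

definition test_functions :: "real set \<Rightarrow> (real \<Rightarrow> real) set" where
  "test_functions \<Omega> = {\<eta>. \<eta> C1_differentiable_on UNIV \<and>
     compact (closure {x. \<eta> x \<noteq> 0}) \<and> closure {x. \<eta> x \<noteq> 0} \<subseteq> \<Omega>}"

subsection \<open>The Sobolev space \<open>H\<^sup>1\<^sub>0\<close>\<close>

definition has_weak_derivative :: "real set \<Rightarrow> (real \<Rightarrow> real) \<Rightarrow> (real \<Rightarrow> real) \<Rightarrow> bool" where
  "has_weak_derivative \<Omega> \<phi> g \<longleftrightarrow> \<phi> \<in> L2 \<Omega> \<and> g \<in> L2 \<Omega> \<and>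
     (\<forall>\<eta>\<in>test_functions \<Omega>.
        (LINT x|lebesgue_on \<Omega>. \<phi> x * deriv \<eta> x) = - (LINT x|lebesgue_on \<Omega>. g x * \<eta> x))"

text \<open>The closure of the test functions in \<open>H\<^sup>1(\<Omega>)\<close>.\<close>

definition H1_0 :: "real set \<Rightarrow> (real \<Rightarrow> real) set" where
  "H1_0 \<Omega> = {\<phi>. \<exists>g. has_weak_derivative \<Omega> \<phi> g \<and>
     (\<exists>\<eta> :: nat \<Rightarrow> real \<Rightarrow> real. (\<forall>n. \<eta> n \<in> test_functions \<Omega>) \<and>
        (\<lambda>n. L2_norm \<Omega> (\<lambda>x. \<eta> n x - \<phi> x)) \<longlonglongrightarrow> 0 \<and>
        (\<lambda>n. L2_norm \<Omega> (\<lambda>x. deriv (\<eta> n) x - g x)) \<longlonglongrightarrow> 0)}"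

subsection \<open>Finite signed measures\<close>

text \<open>A signed measure is a real set function on the Borel subsets of \<open>\<Omega>\<close>; its values on other
  sets are irrelevant. On open subsets of the line, finite signed Borel measures are
  automatically Radon.\<close>

abbreviation borel_sets :: "real set \<Rightarrow> real set set" where
  "borel_sets \<Omega> \<equiv> sets (restrict_space borel \<Omega>)"

definition variation :: "real set \<Rightarrow> (real set \<Rightarrow> real) \<Rightarrow> real set \<Rightarrow> ennreal" where
  "variation \<Omega> \<mu> A =
     (SUP P\<in>{P. finite P \<and> P \<subseteq> borel_sets \<Omega> \<and> disjoint P \<and> \<Union>P = A}. \<Sum>B\<in>P. ennreal \<bar>\<mu> B\<bar>)"

definition variation_measure :: "real set \<Rightarrow> (real set \<Rightarrow> real) \<Rightarrow> real measure" where
  "variation_measure \<Omega> \<mu> = measure_of \<Omega> (borel_sets \<Omega>) (variation \<Omega> \<mu>)"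

definition finite_radon_measure :: "real set \<Rightarrow> (real set \<Rightarrow> real) \<Rightarrow> bool" where
  "finite_radon_measure \<Omega> \<mu> \<longleftrightarrow> \<mu> {} = 0 \<and>
     (\<forall>A :: nat \<Rightarrow> real set. range A \<subseteq> borel_sets \<Omega> \<longrightarrow> disjoint_family A \<longrightarrow>
        (\<lambda>n. \<mu> (A n)) sums \<mu> (\<Union>n. A n)) \<and>
     variation \<Omega> \<mu> \<Omega> < \<infinity>"

definition radon_norm :: "real set \<Rightarrow> (real set \<Rightarrow> real) \<Rightarrow> real" where
  "radon_norm \<Omega> \<mu> = enn2real (variation \<Omega> \<mu> \<Omega>)"

text \<open>\<open>polar_decomposition \<Omega> \<mu> \<sigma>\<close> says that \<open>\<mu> = \<sigma>|\<mu>|\<close> with \<open>|\<sigma>| = 1\<close>, i.e. \<open>\<sigma>\<close> is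
  (a version of) \<open>sgn(\<mu>)\<close>.\<close>

definition polar_decomposition :: "real set \<Rightarrow> (real set \<Rightarrow> real) \<Rightarrow> (real \<Rightarrow> real) \<Rightarrow> bool" where
  "polar_decomposition \<Omega> \<mu> \<sigma> \<longleftrightarrow>
     \<sigma> \<in> borel_measurable (variation_measure \<Omega> \<mu>) \<and> (\<forall>x\<in>\<Omega>. \<bar>\<sigma> x\<bar> = 1) \<and>
     (\<forall>A\<in>borel_sets \<Omega>. \<mu> A = (LINT x:A|variation_measure \<Omega> \<mu>. \<sigma> x))"

definition Sgn :: "real set \<Rightarrow> (real set \<Rightarrow> real) \<Rightarrow> (real \<Rightarrow> real) set" where
  "Sgn \<Omega> \<mu> = {v. v \<in> borel_measurable (lebesgue_on \<Omega>) \<and>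
     v \<in> borel_measurable (variation_measure \<Omega> \<mu>) \<and>
     (AE x in lebesgue_on \<Omega>. \<bar>v x\<bar> \<le> 1) \<and> (AE x in variation_measure \<Omega> \<mu>. \<bar>v x\<bar> \<le> 1) \<and>
     (\<exists>\<sigma>. polar_decomposition \<Omega> \<mu> \<sigma> \<and> (AE x in variation_measure \<Omega> \<mu>. v x = \<sigma> x))}"

subsection \<open>Functions of bounded variation\<close>

text \<open>The integral of \<open>\<eta>\<close> against \<open>\<mu>\<close> is the integral of \<open>\<eta> sgn(\<mu>)\<close> against \<open>|\<mu>|\<close>.\<close>

definition is_distr_derivative :: "real set \<Rightarrow> (real \<Rightarrow> real) \<Rightarrow> (real set \<Rightarrow> real) \<Rightarrow> bool" where
  "is_distr_derivative \<Omega> u \<mu> \<longleftrightarrow> finite_radon_measure \<Omega> \<mu> \<and>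
     (\<exists>\<sigma>. polar_decomposition \<Omega> \<mu> \<sigma> \<and>
        (\<forall>\<eta>\<in>test_functions \<Omega>.
           (LINT x|lebesgue_on \<Omega>. u x * deriv \<eta> x) =
           - (LINT x|variation_measure \<Omega> \<mu>. \<eta> x * \<sigma> x)))"

definition BV :: "real set \<Rightarrow> (real \<Rightarrow> real) set" where
  "BV \<Omega> = {u. integrable (lebesgue_on \<Omega>) u \<and> (\<exists>\<mu>. is_distr_derivative \<Omega> u \<mu>)}"

text \<open>The choice is harmless: two distributional derivatives of \<open>u\<close> agree on the Borel subsets
  of \<open>\<Omega>\<close>.\<close>

definition distr_derivative :: "real set \<Rightarrow> (real \<Rightarrow> real) \<Rightarrow> real set \<Rightarrow> real" where
  "distr_derivative \<Omega> u = (SOME \<mu>. is_distr_derivative \<Omega> u \<mu>)"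

definition D_minus :: "real set \<Rightarrow> (real \<Rightarrow> real) \<Rightarrow> (real \<Rightarrow> real) \<Rightarrow> real set \<Rightarrow> real" where
  "D_minus \<Omega> u w A = distr_derivative \<Omega> u A - (LINT x:A|lebesgue. w x)"

subsection \<open>The variational problem\<close>

definition energy ::
  "real set \<Rightarrow> (real \<Rightarrow> real) \<Rightarrow> real \<Rightarrow> real \<Rightarrow> (real \<Rightarrow> real) \<Rightarrow> (real \<Rightarrow> real) \<Rightarrow> real" where
  "energy \<Omega> f \<alpha> \<beta> w u =
     1/2 * (L2_norm \<Omega> (\<lambda>x. f x - u x))\<^sup>2 + \<alpha> * radon_norm \<Omega> (D_minus \<Omega> u w)
     + \<beta>/2 * (L2_norm \<Omega> w)\<^sup>2"

definition solution_pair ::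
  "real set \<Rightarrow> (real \<Rightarrow> real) \<Rightarrow> real \<Rightarrow> real \<Rightarrow> (real \<Rightarrow> real) \<Rightarrow> (real \<Rightarrow> real) \<Rightarrow> bool" where
  "solution_pair \<Omega> f \<alpha> \<beta> w u \<longleftrightarrow> u \<in> BV \<Omega> \<and> w \<in> L2 \<Omega> \<and>
     (\<forall>u'\<in>BV \<Omega>. \<forall>w'\<in>L2 \<Omega>. energy \<Omega> f \<alpha> \<beta> w u \<le> energy \<Omega> f \<alpha> \<beta> w' u')"

text \<open>Pointwise values of \<open>\<phi> \<in> H\<^sup>1\<^sub>0\<close> on \<open>[-L,L]\<close> refer to its representative that is continuous
  up to the boundary.\<close>

definition associated_function ::
  "real \<Rightarrow> (real \<Rightarrow> real) \<Rightarrow> real \<Rightarrow> real \<Rightarrow> (real \<Rightarrow> real) \<Rightarrow> (real \<Rightarrow> real) \<Rightarrow> (real \<Rightarrow> real) \<Rightarrow> bool" where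
  "associated_function L f \<alpha> \<beta> w u \<phi> \<longleftrightarrow>
     \<phi> \<in> H1_0 {-L<..<L} \<and> continuous_on {-L..L} \<phi> \<and>
     has_weak_derivative {-L<..<L} \<phi> (\<lambda>x. u x - f x) \<and>
     \<phi> \<in> (\<lambda>v x. \<alpha> * v x) ` Sgn {-L<..<L} (D_minus {-L<..<L} u w) \<and>
     (AE x in lebesgue_on {-L<..<L}. \<phi> x = \<beta> * w x)"

subsection \<open>The two types of solutions\<close>

definition representative :: "real \<Rightarrow> (real \<Rightarrow> real) \<Rightarrow> (real \<Rightarrow> real) \<Rightarrow> bool" where
  "representative L u v \<longleftrightarrow> (AE x in lebesgue_on {-L<..<L}. u x = v x)"

text \<open>\<open>left_data L u v\<close>: \<open>v\<close> represents \<open>u\<close>, its value at \<open>0\<close> is the one coming from the left half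
  \<open>(-L,0]\<close>, and \<open>v'(-L) = 0\<close> one-sidedly (so that \<open>v (-L)\<close> is the limit of \<open>v\<close> at \<open>-L\<close>).\<close>

definition left_data :: "real \<Rightarrow> (real \<Rightarrow> real) \<Rightarrow> (real \<Rightarrow> real) \<Rightarrow> bool" where
  "left_data L u v \<longleftrightarrow> representative L u v \<and> (v \<longlongrightarrow> v 0) (at_left 0) \<and>
     (v has_real_derivative 0) (at (-L) within {-L..0})"

definition continuous_type ::
  "real \<Rightarrow> real \<Rightarrow> real \<Rightarrow> (real \<Rightarrow> real) \<Rightarrow> (real \<Rightarrow> real) \<Rightarrow> bool" where
  "continuous_type L h \<alpha> u \<phi> \<longleftrightarrow>
     (\<exists>v. left_data L u v \<and> continuous_on {-L<..<L} v \<and> v 0 = h/2) \<and> \<phi> (-L) = 0 \<and> \<phi> 0 < \<alpha>"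

definition jump_type ::
  "real \<Rightarrow> real \<Rightarrow> real \<Rightarrow> (real \<Rightarrow> real) \<Rightarrow> (real \<Rightarrow> real) \<Rightarrow> bool" where
  "jump_type L h \<alpha> u \<phi> \<longleftrightarrow>
     (\<exists>v. left_data L u v \<and> (\<exists>r. (v \<longlongrightarrow> r) (at_right 0) \<and> r \<noteq> v 0) \<and> v 0 < h/2)
     \<and> \<phi> (-L) = 0 \<and> \<phi> 0 = \<alpha>"

definition has_profile :: "real \<Rightarrow> real \<Rightarrow> real \<Rightarrow> (real \<Rightarrow> real) \<Rightarrow> real \<Rightarrow> real \<Rightarrow> bool" where
  "has_profile L h k u c1 c2 \<longleftrightarrow> representative L u
     (\<lambda>x. if x \<le> 0 then c1 * exp (k * x) + c2 * exp (- k * x)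
          else h - c1 * exp (- k * x) - c2 * exp (k * x))"

end

theory Submission
  imports Defs
begin

text \<open>The optimality system is monotone. Let \<open>(v, \<psi>)\<close> be the explicit profile, which solves
  \<open>\<psi>' = v - f\<close>, \<open>Dv = \<psi>/\<beta> + J \<delta>\<^sub>0\<close> with \<open>\<bar>\<psi>\<bar> \<le> \<alpha>\<close>, \<open>J \<ge> 0\<close>, and \<open>\<psi>(0) = \<alpha>\<close> unless \<open>J = 0\<close>.
  Since \<open>\<phi>\<close> attains the total variation of \<open>\<mu> = Du - w\<close> while \<open>\<psi>\<close> does not exceed it,
  \<open>J (\<psi> - \<phi>)(0) - \<integral>(\<psi> - \<phi>) d\<mu> \<ge> 0\<close>; integrating by parts, the left-hand side equals
  \<open>- \<integral>(v - u)\<^sup>2 - \<integral>(\<psi> - \<phi>)\<^sup>2/\<beta>\<close>. Hence \<open>u = v\<close> and \<open>\<phi> = \<psi>\<close>. The profile of (i) is admissible iff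
  \<open>tanh (k L) / k \<le> 2 \<alpha> / h\<close>, the one of (ii) iff \<open>tanh (k L) / k \<ge> 2 \<alpha> / h\<close>.\<close>

subsection \<open>Square-integrable functions\<close>

text \<open>Comparison with an explicit candidate avoids solving the system for u and \<phi>, which
  would require locating the set where \<bar>\<phi>\<bar> = \<alpha>, on which Du - w may be
  concentrated, while u is merely BV. The obstacle is the integration by parts. Du and weak
  derivatives are defined by testing with compactly supported C^1 functions, but \<phi> and \<psi>
  themselves have to be tested with. Since Du may have atoms, L2 convergence of approximants is too
  weak. In one dimension, however, L2 convergence of the derivatives forces uniform convergence of
  functions vanishing at the ends, and this passes to the limit under any finite measure. The
  constants are read off the candidate: \<psi>(L) = 0 forces
  \<open>c1 = c2 * exp (2 * k * L)\<close>; absence of a jump is 2 (c1 + c2) = h; a jump needs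
  \<psi>(0) = (c1 - c2) / k = \<alpha>. If tanh (k L) / k = 2 \<alpha> / h, both candidates
  coincide: u is continuous, yet \<phi>(0) = \<alpha>, so this case is of neither type.\<close>

lemma L2_measurable: "g \<in> L2 \<Omega> \<Longrightarrow> g \<in> borel_measurable (lebesgue_on \<Omega>)"
  and L2_integrable_square: "g \<in> L2 \<Omega> \<Longrightarrow> integrable (lebesgue_on \<Omega>) (\<lambda>x. (g x)\<^sup>2)"
  by (auto simp: L2_def)

lemma L2_mult_integrable:
  assumes "f \<in> L2 \<Omega>" "g \<in> L2 \<Omega>"
  shows "integrable (lebesgue_on \<Omega>) (\<lambda>x. f x * g x)"
proof (rule Bochner_Integration.integrable_bound)
  show "integrable (lebesgue_on \<Omega>) (\<lambda>x. (f x)\<^sup>2 + (g x)\<^sup>2)"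
    using assms by (auto simp: L2_def)
  show "(\<lambda>x. f x * g x) \<in> borel_measurable (lebesgue_on \<Omega>)"
    using assms by (auto simp: L2_def)
  have "\<bar>a * b\<bar> \<le> a\<^sup>2 + b\<^sup>2" for a b :: real
  proof -
    have "2 * (\<bar>a\<bar> * \<bar>b\<bar>) \<le> a\<^sup>2 + b\<^sup>2"
      using sum_squares_bound[of "\<bar>a\<bar>" "\<bar>b\<bar>"] by (simp add: mult.assoc)
    moreover have "0 \<le> \<bar>a\<bar> * \<bar>b\<bar>" by simp
    ultimately show ?thesis unfolding abs_mult by linarith
  qed
  then show "AE x in lebesgue_on \<Omega>. norm (f x * g x) \<le> norm ((f x)\<^sup>2 + (g x)\<^sup>2)"
    by simp
qed

lemma L2_diff:
  assumes "f \<in> L2 \<Omega>" "g \<in> L2 \<Omega>"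
  shows "(\<lambda>x. f x - g x) \<in> L2 \<Omega>"
proof -
  have "integrable (lebesgue_on \<Omega>) (\<lambda>x. (f x)\<^sup>2 - 2 * (f x * g x) + (g x)\<^sup>2)"
    using assms L2_mult_integrable[OF assms] by (auto simp: L2_def)
  then have "integrable (lebesgue_on \<Omega>) (\<lambda>x. (f x - g x)\<^sup>2)"
    by (simp add: power2_diff algebra_simps)
  then show ?thesis using assms by (auto simp: L2_def)
qed

lemma L2_add:
  assumes "f \<in> L2 \<Omega>" "g \<in> L2 \<Omega>"
  shows "(\<lambda>x. f x + g x) \<in> L2 \<Omega>"
proof -
  have "(\<lambda>x. 0 - g x) \<in> L2 \<Omega>"
    using assms(2) by (auto simp: L2_def)
  from L2_diff[OF assms(1) this] show ?thesis by simp
qed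

lemma finite_measure_interval: "finite_measure (lebesgue_on {a<..<b::real})"
  by (simp add: finite_measure_lebesgue_on)

lemma L2_bounded:
  fixes a b :: real
  assumes "g \<in> borel_measurable (lebesgue_on {a<..<b})" "\<And>x. x \<in> {a<..<b} \<Longrightarrow> \<bar>g x\<bar> \<le> B"
  shows "g \<in> L2 {a<..<b}"
proof -
  interpret finite_measure "lebesgue_on {a<..<b}" by (rule finite_measure_interval)
  have "integrable (lebesgue_on {a<..<b}) (\<lambda>x. (g x)\<^sup>2)"
  proof (rule integrable_const_bound)
    show "AE x in lebesgue_on {a<..<b}. norm ((g x)\<^sup>2) \<le> B\<^sup>2"
      using power_mono[OF assms(2) abs_ge_zero, of _ 2] by (intro AE_I2) auto
    show "(\<lambda>x. (g x)\<^sup>2) \<in> borel_measurable (lebesgue_on {a<..<b})"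
      using assms(1) by simp
  qed
  then show ?thesis using assms(1) by (simp add: L2_def)
qed

lemma L2_continuous:
  fixes a b :: real
  assumes "continuous_on {a..b} g"
  shows "g \<in> L2 {a<..<b}"
proof -
  have "bounded (g ` {a..b})"
    by (intro compact_imp_bounded compact_continuous_image assms compact_Icc)
  then obtain B where "\<forall>y\<in>g ` {a..b}. norm y \<le> B"
    unfolding bounded_iff by blast
  moreover have "g \<in> borel_measurable (lebesgue_on {a<..<b})"
    by (rule continuous_imp_measurable_on_sets_lebesgue)
       (auto intro: continuous_on_subset[OF assms])
  ultimately show ?thesis
    by (intro L2_bounded[where B = B]) auto
qed

lemma L2_integrable:
  fixes a b :: real
  assumes "g \<in> L2 {a<..<b}"
  shows "integrable (lebesgue_on {a<..<b}) g"
proof -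
  have "(\<lambda>_. 1) \<in> L2 {a<..<b}" by (rule L2_continuous) simp
  from L2_mult_integrable[OF assms this] show ?thesis by simp
qed

text \<open>Young's inequality with weight \<epsilon> equal to the norm of \<open>d\<close>, or with
  \<epsilon> tending to 0 if that norm is 0. The constant is cruder than in Cauchy-Schwarz; what
  matters later is that it does not involve \<open>d\<close>, so the pairing vanishes as
  \<open>d\<close> tends to 0 in L2.\<close>

lemma L2_pairing_bound:
  assumes "U \<in> L2 \<Omega>" "d \<in> L2 \<Omega>"
  shows "\<bar>LINT x|lebesgue_on \<Omega>. U x * d x\<bar>
    \<le> ((LINT x|lebesgue_on \<Omega>. (U x)\<^sup>2) + 1) / 2 * L2_norm \<Omega> d"
proof -
  let ?M = "lebesgue_on \<Omega>"
  define A D where "A = (LINT x|?M. (U x)\<^sup>2)" and "D = (LINT x|?M. (d x)\<^sup>2)"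
  have A0: "A \<ge> 0" and D0: "D \<ge> 0" by (auto simp: A_def D_def)
  have young: "\<bar>LINT x|?M. U x * d x\<bar> \<le> (\<epsilon> * A + D / \<epsilon>) / 2" if "\<epsilon> > 0" for \<epsilon>
  proof -
    have "\<bar>LINT x|?M. U x * d x\<bar> \<le> (LINT x|?M. (\<epsilon> * (U x)\<^sup>2 + (d x)\<^sup>2 / \<epsilon>) / 2)"
    proof (rule integral_abs_bound_integral)
      show "integrable ?M (\<lambda>x. U x * d x)" by (rule L2_mult_integrable[OF assms])
      show "integrable ?M (\<lambda>x. (\<epsilon> * (U x)\<^sup>2 + (d x)\<^sup>2 / \<epsilon>) / 2)"
        using assms by (auto simp: L2_def)
      fix x
      have "0 \<le> (\<epsilon> * \<bar>U x\<bar> - \<bar>d x\<bar>)\<^sup>2" by simp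
      then have "2 * \<epsilon> * (\<bar>U x\<bar> * \<bar>d x\<bar>) \<le> \<epsilon>\<^sup>2 * (U x)\<^sup>2 + (d x)\<^sup>2"
        by (simp add: power2_diff power_mult_distrib)
      then show "\<bar>U x * d x\<bar> \<le> (\<epsilon> * (U x)\<^sup>2 + (d x)\<^sup>2 / \<epsilon>) / 2"
        using that by (simp add: field_simps power2_eq_square abs_mult)
    qed
    also have "\<dots> = (\<epsilon> * A + D / \<epsilon>) / 2"
      using assms by (simp add: L2_def A_def D_def)
    finally show ?thesis .
  qed
  show ?thesis
  proof (cases "D = 0")
    case True
    have "\<bar>LINT x|?M. U x * d x\<bar> \<le> 0 + e" if "e > 0" for e
    proof -
      have "\<bar>LINT x|?M. U x * d x\<bar> \<le> (e / (A + 1) * A) / 2"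
        using young[of "e / (A + 1)"] A0 that True by simp
      also have "\<dots> \<le> e" using A0 that by (simp add: field_simps)
      finally show ?thesis by simp
    qed
    then have "\<bar>LINT x|?M. U x * d x\<bar> \<le> 0" by (rule field_le_epsilon)
    then show ?thesis using True D_def by (simp add: L2_norm_def)
  next
    case False
    then have "D / sqrt D = sqrt D" using D0 by (simp add: real_div_sqrt)
    with young[of "sqrt D"] False D0 show ?thesis
      by (simp add: L2_norm_def A_def[symmetric] D_def[symmetric] algebra_simps)
  qed
qed

subsection \<open>Test functions and their limits\<close>

lemma test_functionI:
  assumes d: "\<And>x. (\<eta> has_real_derivative d x) (at x)" and "continuous_on UNIV d"
    and supp: "\<And>x. x \<notin> {a..b} \<Longrightarrow> \<eta> x = 0" and "{a..b} \<subseteq> \<Omega>"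
  shows "\<eta> \<in> test_functions \<Omega>"
proof -
  have "\<eta> C1_differentiable_on UNIV"
    unfolding C1_differentiable_on_def
    using assms by (auto simp: has_real_derivative_iff_has_vector_derivative)
  moreover have sub: "closure {x. \<eta> x \<noteq> 0} \<subseteq> {a..b}"
    by (rule closure_minimal) (use supp in blast, simp)
  moreover have "compact (closure {x. \<eta> x \<noteq> 0})"
    using bounded_subset[OF bounded_closed_interval sub] by (simp only: compact_eq_bounded_closed closed_closure)
  ultimately show ?thesis using assms(4) by (auto simp: test_functions_def)
qed

lemma
  assumes "\<eta> \<in> test_functions \<Omega>"
  shows test_function_deriv: "(\<eta> has_real_derivative deriv \<eta> x) (at x)"
    and test_function_continuous_deriv: "continuous_on S (deriv \<eta>)"
    and test_function_outside: "x \<notin> \<Omega> \<Longrightarrow> \<eta> x = 0"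
    and test_function_continuous: "continuous_on S \<eta>"
    and test_function_bounded: "bounded (range \<eta>)"
proof -
  obtain D where D: "\<And>x. (\<eta> has_real_derivative D x) (at x)" "continuous_on UNIV D"
    using assms unfolding test_functions_def C1_differentiable_on_def
    by (auto simp: has_real_derivative_iff_has_vector_derivative)
  have eq: "deriv \<eta> = D" using D(1) DERIV_imp_deriv by blast
  show "(\<eta> has_real_derivative deriv \<eta> x) (at x)" using D(1) eq by simp
  show "continuous_on S (deriv \<eta>)" using D(2) eq continuous_on_subset by blast
  have sub: "{x. \<eta> x \<noteq> 0} \<subseteq> closure {x. \<eta> x \<noteq> 0}" by (rule closure_subset)
  then show "x \<notin> \<Omega> \<Longrightarrow> \<eta> x = 0" using assms by (auto simp: test_functions_def)
  have c: "continuous_on S \<eta>" for S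
    using D(1) by (meson DERIV_isCont continuous_at_imp_continuous_on)
  then show "continuous_on S \<eta>" .
  have "bounded (\<eta> ` closure {x. \<eta> x \<noteq> 0})"
    using assms c by (intro compact_imp_bounded compact_continuous_image) (auto simp: test_functions_def)
  moreover have "range \<eta> \<subseteq> insert 0 (\<eta> ` closure {x. \<eta> x \<noteq> 0})"
    using sub by auto
  ultimately show "bounded (range \<eta>)" by (meson bounded_insert bounded_subset)
qed

text \<open>The exceptional set \<open>S\<close> serves for the point 0, where the functions built
  from \<bar>x\<bar> have a kink. Integrability of \<open>f\<close> identifies the gauge integral of
  the fundamental theorem with the Lebesgue integral.\<close>

lemma integral_lebesgue_on_FTC:
  fixes F f :: "real \<Rightarrow> real"
  assumes "a \<le> b" "finite S"
    and "\<And>x. x \<in> {a<..<b} - S \<Longrightarrow> (F has_real_derivative f x) (at x)"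
    and "continuous_on {a..b} F" and int: "integrable (lebesgue_on {a<..<b}) f"
  shows "(LINT x|lebesgue_on {a<..<b}. f x) = F b - F a"
proof -
  have "(f has_integral (F b - F a)) {a..b}"
    using fundamental_theorem_of_calculus_interior_strong[of S a b F f] assms
    by (auto simp: has_real_derivative_iff_has_vector_derivative)
  then have "integral {a<..<b} f = F b - F a"
    by (simp add: integral_open_interval_real[symmetric] integral_unique)
  moreover have "(LINT x|lebesgue_on {a<..<b}. f x) = integral {a<..<b} f"
    by (rule lebesgue_integral_eq_integral[OF int]) simp
  ultimately show ?thesis by simp
qed

lemma integral_indicator_lessThan:
  fixes a b x :: real and g :: "real \<Rightarrow> real"
  assumes "x \<in> {a<..<b}"
  shows "(LINT t|lebesgue_on {a<..<b}. indicator {..<x} t * g t) = (LINT t|lebesgue_on {a<..<x}. g t)"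
proof -
  have "(LINT t|lebesgue_on {a<..<b}. indicator {..<x} t * g t)
      = (LINT t|lebesgue. indicator {a<..<b} t *\<^sub>R (indicator {..<x} t * g t))"
    by (rule integral_restrict_space) simp
  also have "\<dots> = (LINT t|lebesgue. indicator {a<..<x} t *\<^sub>R g t)"
    using assms by (intro Bochner_Integration.integral_cong) (auto simp: indicator_def)
  also have "\<dots> = (LINT t|lebesgue_on {a<..<x}. g t)"
    by (rule integral_restrict_space[symmetric]) simp
  finally show ?thesis .
qed

text \<open>Uniform convergence is the mode that survives integration against a measure singular to
  Lebesgue measure. With \<open>N\<close> the variation measure of Du and \<sigma> its sign, this is
  continuity of the pairing with Du.\<close>

lemma uniform_limit_integral_mult:
  fixes \<sigma> :: "real \<Rightarrow> real"
  assumes \<sigma>: "integrable N \<sigma>" and meas: "\<And>n. \<eta> n \<in> borel_measurable N"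
    and bdd: "\<And>n::nat. bounded (\<eta> n ` space N)"
    and lim: "uniform_limit (space N) \<eta> \<psi> sequentially"
  shows "integrable N (\<lambda>x. \<psi> x * \<sigma> x)"
    and "(\<lambda>n. LINT x|N. \<eta> n x * \<sigma> x) \<longlonglongrightarrow> (LINT x|N. \<psi> x * \<sigma> x)"
proof -
  have int: "integrable N (\<lambda>x. \<xi> x * \<sigma> x)"
    if "\<xi> \<in> borel_measurable N" "\<And>x. x \<in> space N \<Longrightarrow> \<bar>\<xi> x\<bar> \<le> B" for \<xi> B
  proof (rule Bochner_Integration.integrable_bound)
    show "integrable N (\<lambda>x. B * \<sigma> x)" using \<sigma> by simp
    show "(\<lambda>x. \<xi> x * \<sigma> x) \<in> borel_measurable N" using \<sigma> that by measurable
    show "AE x in N. norm (\<xi> x * \<sigma> x) \<le> norm (B * \<sigma> x)"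
    proof (rule AE_I2)
      fix x assume "x \<in> space N"
      then have "\<bar>\<xi> x\<bar> \<le> \<bar>B\<bar>" using that(2)[of x] by linarith
      then show "norm (\<xi> x * \<sigma> x) \<le> norm (B * \<sigma> x)" by (simp add: abs_mult mult_right_mono)
    qed
  qed
  have \<psi>: "\<psi> \<in> borel_measurable N"
    by (rule borel_measurable_LIMSEQ_real[OF _ meas]) (rule tendsto_uniform_limitI[OF lim])
  have "bounded (\<psi> ` space N)"
    using bdd by (intro uniform_limit_bounded[OF lim] always_eventually) auto
  then obtain B where "\<forall>y\<in>\<psi> ` space N. norm y \<le> B"
    unfolding bounded_iff by blast
  then show \<psi>int: "integrable N (\<lambda>x. \<psi> x * \<sigma> x)"
    by (intro int[OF \<psi>, where B = B]) auto
  have \<eta>int: "integrable N (\<lambda>x. \<eta> n x * \<sigma> x)" for n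
  proof -
    obtain B where "\<forall>y\<in>\<eta> n ` space N. norm y \<le> B"
      using bdd[of n] unfolding bounded_iff by blast
    then show ?thesis by (intro int[OF meas, where B = B]) auto
  qed
  define K where "K = (LINT x|N. \<bar>\<sigma> x\<bar>)"
  have K: "K \<ge> 0" by (simp add: K_def)
  show "(\<lambda>n. LINT x|N. \<eta> n x * \<sigma> x) \<longlonglongrightarrow> (LINT x|N. \<psi> x * \<sigma> x)"
  proof (rule tendstoI)
    fix e :: real assume "e > 0"
    \<comment> \<open>The summand 1 keeps the quotient meaningful when \<open>K\<close> is 0 and
      makes \<open>d * K < e\<close> strict.\<close>
    define d where "d = e / (K + 1)"
    have "d > 0" using K \<open>e > 0\<close> by (simp add: d_def)
    have "d * K < e" using K \<open>e > 0\<close> by (simp add: d_def field_simps)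
    have "\<forall>\<^sub>F n in sequentially. \<forall>x\<in>space N. dist (\<eta> n x) (\<psi> x) < d"
      using uniform_limitD[OF lim \<open>d > 0\<close>] .
    then show "\<forall>\<^sub>F n in sequentially. dist (LINT x|N. \<eta> n x * \<sigma> x) (LINT x|N. \<psi> x * \<sigma> x) < e"
    proof eventually_elim
      fix n assume close: "\<forall>x\<in>space N. dist (\<eta> n x) (\<psi> x) < d"
      have "\<bar>(LINT x|N. \<eta> n x * \<sigma> x) - (LINT x|N. \<psi> x * \<sigma> x)\<bar>
          = \<bar>LINT x|N. \<eta> n x * \<sigma> x - \<psi> x * \<sigma> x\<bar>"
        using \<eta>int \<psi>int by simp
      also have "\<dots> \<le> (LINT x|N. d * \<bar>\<sigma> x\<bar>)"
      proof (rule integral_abs_bound_integral)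
        fix x assume "x \<in> space N"
        then have "\<bar>\<eta> n x - \<psi> x\<bar> \<le> d" using close by (auto simp: dist_real_def intro: less_imp_le)
        then have "\<bar>(\<eta> n x - \<psi> x) * \<sigma> x\<bar> \<le> d * \<bar>\<sigma> x\<bar>"
          by (simp add: abs_mult mult_right_mono)
        then show "\<bar>\<eta> n x * \<sigma> x - \<psi> x * \<sigma> x\<bar> \<le> d * \<bar>\<sigma> x\<bar>"
          by (simp add: left_diff_distrib)
      qed (use \<eta>int \<psi>int \<sigma> in auto)
      also have "\<dots> = d * K" by (simp add: K_def)
      finally show "dist (LINT x|N. \<eta> n x * \<sigma> x) (LINT x|N. \<psi> x * \<sigma> x) < e"
        using \<open>d * K < e\<close> by (simp add: dist_real_def)
    qed
  qed
qed

section \<open>One-dimensional Sobolev embedding and weak formulas beyond test functions\<close>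

lemma L2_test_function:
  fixes a b :: real
  assumes "\<eta> \<in> test_functions {a<..<b}"
  shows "\<eta> \<in> L2 {a<..<b}" and "deriv \<eta> \<in> L2 {a<..<b}"
  using assms by (auto intro!: L2_continuous test_function_continuous test_function_continuous_deriv)

text \<open>Writing the primitive as a pairing with an indicator over the whole interval, instead of
  an integral over a varying one, lets \<open>L2_pairing_bound\<close> control point values by the
  derivative.\<close>

lemma test_function_eq_integral_deriv:
  assumes "\<eta> \<in> test_functions {a<..<b}" "x \<in> {a<..<b}"
  shows "\<eta> x = (LINT t|lebesgue_on {a<..<b}. indicator {..<x} t * deriv \<eta> t)"
proof -
  have "(LINT t|lebesgue_on {a<..<x}. deriv \<eta> t) = \<eta> x - \<eta> a"
    using assms
    by (intro integral_lebesgue_on_FTC[where S = "{}"] L2_integrable L2_continuous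
        test_function_deriv test_function_continuous test_function_continuous_deriv) auto
  moreover have "\<eta> a = 0" by (rule test_function_outside[OF assms(1)]) simp
  ultimately show ?thesis using integral_indicator_lessThan[OF assms(2)] by simp
qed

lemma L2_indicator:
  fixes a b :: real
  assumes "A \<in> sets borel"
  shows "indicator A \<in> L2 {a<..<b}"
proof -
  have "indicator A \<in> borel_measurable (lebesgue_on {a<..<b})"
    using assms by (intro measurable_restrict_space1 borel_measurable_indicator) auto
  then show ?thesis by (rule L2_bounded[where B = 1]) (auto simp: indicator_def)
qed

text \<open>The Sobolev embedding into continuous functions. All the indicators have square at most
  1, so the constant in \<open>L2_pairing_bound\<close> can be taken as half of the interval length
  plus one, independently of x; this is \<open>C\<close>.\<close>

lemma test_functions_uniform_limit:
  assumes \<eta>: "\<And>n::nat. \<eta> n \<in> test_functions {a<..<b}" and g: "g \<in> L2 {a<..<b}"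
    and lim: "(\<lambda>n. L2_norm {a<..<b} (\<lambda>x. deriv (\<eta> n) x - g x)) \<longlonglongrightarrow> 0"
  shows "uniform_limit {a<..<b} \<eta>
    (\<lambda>x. LINT t|lebesgue_on {a<..<b}. indicator {..<x} t * g t) sequentially"
proof -
  let ?M = "lebesgue_on {a<..<b}"
  interpret finite_measure ?M by (rule finite_measure_interval)
  define C where "C = (measure ?M (space ?M) + 1) / 2"
  have C: "C \<ge> 0" by (simp add: C_def)
  have bound: "dist (\<eta> n x) (LINT t|?M. indicator {..<x} t * g t)
      \<le> C * L2_norm {a<..<b} (\<lambda>x. deriv (\<eta> n) x - g x)" if x: "x \<in> {a<..<b}" for n x
  proof -
    let ?I = "indicator {..<x} :: real \<Rightarrow> real"
    let ?d = "\<lambda>t. deriv (\<eta> n) t - g t"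
    have I: "?I \<in> L2 {a<..<b}" by (rule L2_indicator) simp
    have d: "?d \<in> L2 {a<..<b}"
      by (intro L2_diff L2_test_function(2) \<eta> g)
    have "\<eta> n x - (LINT t|?M. ?I t * g t) = (LINT t|?M. ?I t * deriv (\<eta> n) t - ?I t * g t)"
      using test_function_eq_integral_deriv[OF \<eta> x, of n]
        L2_mult_integrable[OF I g] L2_mult_integrable[OF I L2_test_function(2)[OF \<eta>[of n]]] by simp
    then have "dist (\<eta> n x) (LINT t|?M. ?I t * g t) = \<bar>LINT t|?M. ?I t * ?d t\<bar>"
      by (simp add: dist_real_def right_diff_distrib)
    also have "\<dots> \<le> ((LINT t|?M. (?I t)\<^sup>2) + 1) / 2 * L2_norm {a<..<b} ?d"
      by (rule L2_pairing_bound[OF I d])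
    also have "\<dots> \<le> C * L2_norm {a<..<b} ?d"
    proof (rule mult_right_mono)
      have "(LINT t|?M. (?I t)\<^sup>2) \<le> (LINT t|?M. 1)"
        using L2_integrable_square[OF I] by (intro integral_mono) (auto simp: indicator_def)
      then show "((LINT t|?M. (?I t)\<^sup>2) + 1) / 2 \<le> C" by (simp add: C_def)
    qed (simp add: L2_norm_def)
    finally show ?thesis .
  qed
  show ?thesis
  proof (rule uniform_limitI)
    fix e :: real assume "e > 0"
    have "(\<lambda>n. C * L2_norm {a<..<b} (\<lambda>x. deriv (\<eta> n) x - g x)) \<longlonglongrightarrow> 0"
      using tendsto_mult_left[OF lim, of C] by simp
    then have "\<forall>\<^sub>F n in sequentially. C * L2_norm {a<..<b} (\<lambda>x. deriv (\<eta> n) x - g x) < e"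
      by (rule order_tendstoD(2)[OF _ \<open>e > 0\<close>])
    then show "\<forall>\<^sub>F n in sequentially. \<forall>x\<in>{a<..<b}.
        dist (\<eta> n x) (LINT t|?M. indicator {..<x} t * g t) < e"
      by eventually_elim (use bound order.strict_trans1 in blast)
  qed
qed

text \<open>Membership in \<open>H1_0\<close> with derivative \<open>g\<close>, for the
  representative that is the pointwise limit of the test functions. A function known only up to null
  sets could not be integrated against Du or evaluated at 0.\<close>

definition H1_approximable :: "real set \<Rightarrow> (real \<Rightarrow> real) \<Rightarrow> (real \<Rightarrow> real) \<Rightarrow> bool" where
  "H1_approximable \<Omega> \<psi> g \<longleftrightarrow> g \<in> L2 \<Omega> \<and>
     (\<exists>\<eta> :: nat \<Rightarrow> real \<Rightarrow> real. (\<forall>n. \<eta> n \<in> test_functions \<Omega>) \<and>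
        (\<lambda>n. L2_norm \<Omega> (\<lambda>x. deriv (\<eta> n) x - g x)) \<longlonglongrightarrow> 0 \<and> uniform_limit \<Omega> \<eta> \<psi> sequentially)"

text \<open>The left side extends from test functions by L2 convergence of derivatives, the right
  side by uniform convergence, which is all the continuity asked of \<open>T\<close>. Here
  \<open>T\<close> is minus the distributional derivative of \<open>u\<close>: later a pairing with
  a signed measure, or a density plus a point mass at 0.\<close>

lemma H1_approximable_weak_formula:
  assumes \<psi>: "H1_approximable {a<..<b} \<psi> g" and u: "u \<in> L2 {a<..<b}"
    and test: "\<And>\<eta>. \<eta> \<in> test_functions {a<..<b} \<Longrightarrow>
      (LINT x|lebesgue_on {a<..<b}. u x * deriv \<eta> x) = T \<eta>"
    and T: "\<And>\<eta>. (\<And>n::nat. \<eta> n \<in> test_functions {a<..<b}) \<Longrightarrow>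
      uniform_limit {a<..<b} \<eta> \<psi> sequentially \<Longrightarrow> (\<lambda>n. T (\<eta> n)) \<longlonglongrightarrow> T \<psi>"
  shows "(LINT x|lebesgue_on {a<..<b}. u x * g x) = T \<psi>"
proof -
  let ?M = "lebesgue_on {a<..<b}"
  obtain \<eta> :: "nat \<Rightarrow> real \<Rightarrow> real" where g: "g \<in> L2 {a<..<b}"
    and \<eta>: "\<And>n. \<eta> n \<in> test_functions {a<..<b}"
    and lim: "(\<lambda>n. L2_norm {a<..<b} (\<lambda>x. deriv (\<eta> n) x - g x)) \<longlonglongrightarrow> 0"
    and unif: "uniform_limit {a<..<b} \<eta> \<psi> sequentially"
    using \<psi> by (auto simp: H1_approximable_def)
  define C where "C = ((LINT x|?M. (u x)\<^sup>2) + 1) / 2"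
  have "\<bar>T (\<eta> n) - (LINT x|?M. u x * g x)\<bar> \<le> C * L2_norm {a<..<b} (\<lambda>x. deriv (\<eta> n) x - g x)" for n
  proof -
    have d: "(\<lambda>x. deriv (\<eta> n) x - g x) \<in> L2 {a<..<b}"
      by (intro L2_diff L2_test_function(2) \<eta> g)
    have "T (\<eta> n) - (LINT x|?M. u x * g x) = (LINT x|?M. u x * (deriv (\<eta> n) x - g x))"
      using L2_mult_integrable[OF u g] L2_mult_integrable[OF u L2_test_function(2)[OF \<eta>[of n]]]
      by (simp add: test[OF \<eta>, symmetric] right_diff_distrib)
    then show ?thesis using L2_pairing_bound[OF u d] by (simp add: C_def)
  qed
  then have "\<forall>\<^sub>F n in sequentially. norm (T (\<eta> n) - (LINT x|?M. u x * g x))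
      \<le> C * L2_norm {a<..<b} (\<lambda>x. deriv (\<eta> n) x - g x)"
    unfolding real_norm_def by (intro always_eventually allI)
  moreover have "(\<lambda>n. C * L2_norm {a<..<b} (\<lambda>x. deriv (\<eta> n) x - g x)) \<longlonglongrightarrow> 0"
    using tendsto_mult_left[OF lim, of C] by simp
  ultimately have "(\<lambda>n. T (\<eta> n) - (LINT x|?M. u x * g x)) \<longlonglongrightarrow> 0"
    by (rule Lim_null_comparison)
  then have "(\<lambda>n. T (\<eta> n)) \<longlonglongrightarrow> (LINT x|?M. u x * g x)"
    by (simp add: LIM_zero_iff)
  moreover have "(\<lambda>n. T (\<eta> n)) \<longlonglongrightarrow> T \<psi>" using T \<eta> unif by blast
  ultimately show ?thesis by (rule LIMSEQ_unique)
qed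

section \<open>The fundamental lemma of the calculus of variations\<close>

lemma has_real_derivative_max_square:
  "((\<lambda>x::real. (max 0 x)\<^sup>2) has_real_derivative 2 * max 0 x) (at x)"
proof -
  consider "x > 0" | "x < 0" | "x = 0" by linarith
  then show ?thesis
  proof cases
    case 1
    have "((\<lambda>x::real. x\<^sup>2) has_real_derivative 2 * max 0 x) (at x)"
      using 1 by (auto intro!: derivative_eq_intros)
    then show ?thesis
      by (rule DERIV_cong_ev[OF refl _ refl, THEN iffD1, rotated])
        (use 1 in \<open>auto intro: eventually_mono[OF eventually_nhds_in_open[of "{0<..}"]]\<close>)
  next
    case 2
    have "((\<lambda>x::real. 0) has_real_derivative 2 * max 0 x) (at x)"
      using 2 by (auto intro!: derivative_eq_intros)
    then show ?thesis
      by (rule DERIV_cong_ev[OF refl _ refl, THEN iffD1, rotated])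
        (use 2 in \<open>auto intro: eventually_mono[OF eventually_nhds_in_open[of "{..<0}"]]\<close>)
  next
    case 3
    have "((\<lambda>h::real. (max 0 h)\<^sup>2 / h) \<longlongrightarrow> 0) (at 0)"
    proof (rule Lim_null_comparison)
      show "((\<lambda>h::real. \<bar>h\<bar>) \<longlongrightarrow> 0) (at 0)" by (auto intro!: tendsto_eq_intros)
      show "\<forall>\<^sub>F h in at 0. norm ((max 0 h)\<^sup>2 / h) \<le> \<bar>h :: real\<bar>"
        by (intro always_eventually) (auto simp: max_def power2_eq_square)
    qed
    then show ?thesis using 3 by (simp add: DERIV_def)
  qed
qed

lemma polynomial_approximation_Icc:
  fixes c :: "real \<Rightarrow> real"
  assumes "continuous_on {a..b} c" "0 < e"
  obtains p p' where "\<And>x. (p has_real_derivative p' x) (at x)" "continuous_on UNIV p'"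
    "\<And>x. x \<in> {a..b} \<Longrightarrow> \<bar>c x - p x\<bar> < e"
proof -
  obtain p where p: "polynomial_function p" "\<And>x. x \<in> {a..b} \<Longrightarrow> norm (c x - p x) < e"
    using Stone_Weierstrass_polynomial_function[OF compact_Icc assms] by blast
  obtain p' where "polynomial_function p'" "\<And>x. (p has_vector_derivative p' x) (at x)"
    using has_vector_derivative_polynomial_function[OF p(1)] by blast
  with p(2) show thesis
    by (intro that[of p p'])
      (auto simp: has_real_derivative_iff_has_vector_derivative intro: continuous_on_polymonial_function)
qed

text \<open>The test functions used are \<open>p\<^sub>n q\<^sub>n\<close> with polynomials \<open>p\<^sub>n \<rightarrow> sgn D\<close> a.e. and bumps
  \<open>q\<^sub>n \<rightarrow> (L\<^sup>2 - x\<^sup>2)\<^sup>2\<close>; in the limit \<open>\<integral> \<bar>D\<bar> (L\<^sup>2 - x\<^sup>2)\<^sup>2 = 0\<close>.\<close>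

lemma integral_test_functions_eq_0_imp_AE_eq_0:
  fixes D :: "real \<Rightarrow> real"
  assumes L: "L > 0" and D: "D \<in> L2 {-L<..<L}"
    and test: "\<And>\<eta>. \<eta> \<in> test_functions {-L<..<L} \<Longrightarrow> (LINT x|lebesgue_on {-L<..<L}. D x * \<eta> x) = 0"
  shows "AE x in lebesgue_on {-L<..<L}. D x = 0"
proof -
  let ?M = "lebesgue_on {-L<..<L}"
  define s where "s x = sgn (D x)" for x
  have "s \<in> borel_measurable ?M"
    unfolding s_def using L2_measurable[OF D] by measurable
  \<comment> \<open>This form of measurability supplies continuous functions converging to sgn D off
    a negligible set.\<close>
  then have "s measurable_on {-L<..<L}"
    by (simp add: measurable_on_iff_borel_measurable)
  then obtain N c where N: "negligible N" and c: "\<And>n. continuous_on UNIV (c n)"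
    and c_lim: "\<And>x. x \<notin> N \<Longrightarrow> (\<lambda>n. c n x) \<longlonglongrightarrow> (if x \<in> {-L<..<L} then s x else 0)"
    unfolding measurable_on_def by blast
  \<comment> \<open>Clipping to [-1,1] does not change the limit, whose values are signs, but bounds
    the approximants uniformly in n. As the polynomials are within 1 / Suc n of them, they are
    bounded by 2, the factor in the dominating function.\<close>
  define c' where "c' n x = max (-1) (min 1 (c n x))" for n x
  have c': "continuous_on {-L..L} (c' n)" for n
    unfolding c'_def using c[of n] by (intro continuous_intros) (auto intro: continuous_on_subset)
  have "\<exists>p p'. (\<forall>x. (p has_real_derivative p' x) (at x)) \<and> continuous_on UNIV p' \<and>
      (\<forall>x\<in>{-L..L}. \<bar>c' n x - p x\<bar> < 1 / Suc n)" for n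
    using polynomial_approximation_Icc[OF c', of "1 / Suc n" n] by (metis of_nat_0_less_iff zero_less_Suc zero_less_divide_1_iff)
  then obtain p p' where p: "\<And>n x. (p n has_real_derivative p' n x) (at x)"
    and p': "\<And>n. continuous_on UNIV (p' n)"
    and p_close: "\<And>n x. x \<in> {-L..L} \<Longrightarrow> \<bar>c' n x - p n x\<bar> < 1 / Suc n"
    by metis
  define r where "r n = L * (1 - 1 / real (Suc n))" for n
  have r: "0 \<le> r n" "r n < L" for n using L by (auto simp: r_def field_simps)
  have r_lim: "r \<longlonglongrightarrow> L"
  proof -
    have "(\<lambda>n. L * (1 - inverse (real (Suc n)))) \<longlonglongrightarrow> L * (1 - 0)"
      by (intro tendsto_intros LIMSEQ_inverse_real_of_nat)
    then show ?thesis by (simp add: r_def[abs_def] inverse_eq_divide del: of_nat_Suc)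
  qed
  \<comment> \<open>Squaring the positive part makes the bump C^1, and \<open>r n < L\<close> keeps
    its closed support inside the open interval.\<close>
  define q where "q n x = (max 0 ((r n)\<^sup>2 - x\<^sup>2))\<^sup>2" for n and x :: real
  define q' where "q' n x = 2 * max 0 ((r n)\<^sup>2 - x\<^sup>2) * (- 2 * x)" for n and x :: real
  have q: "(q n has_real_derivative q' n x) (at x)" for n x
    unfolding q_def q'_def
    by (rule DERIV_chain2[OF has_real_derivative_max_square]) (auto intro!: derivative_eq_intros)
  define \<eta> where "\<eta> n x = p n x * q n x" for n x
  have \<eta>: "\<eta> n \<in> test_functions {-L<..<L}" for n
  proof (rule test_functionI)
    show "(\<eta> n has_real_derivative p' n x * q n x + q' n x * p n x) (at x)" for x
      unfolding \<eta>_def by (rule DERIV_mult[OF p q])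
    have "continuous_on UNIV (p n)"
      using p by (meson DERIV_isCont continuous_at_imp_continuous_on)
    then show "continuous_on UNIV (\<lambda>x. p' n x * q n x + q' n x * p n x)"
      unfolding q_def q'_def by (intro continuous_intros p')
    show "\<eta> n x = 0" if "x \<notin> {- r n..r n}" for x
    proof -
      have "r n < \<bar>x\<bar>" using that by auto
      then have "(r n)\<^sup>2 \<le> x\<^sup>2" using r(1)[of n] abs_le_square_iff[of "r n" x] by simp
      then show ?thesis by (simp add: \<eta>_def q_def)
    qed
    show "{- r n..r n} \<subseteq> {-L<..<L}" using r[of n] by auto
  qed
  have "(\<lambda>n. LINT x|?M. D x * \<eta> n x) \<longlonglongrightarrow> (LINT x|?M. D x * (s x * (L\<^sup>2 - x\<^sup>2)\<^sup>2))"
  proof (rule integral_dominated_convergence)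
    show "integrable ?M (\<lambda>x. \<bar>D x\<bar> * (2 * (L\<^sup>2)\<^sup>2))"
      using L2_integrable[OF D] by simp
    have id: "(\<lambda>x. x) \<in> borel_measurable ?M"
      by (simp add: continuous_imp_measurable_on_sets_lebesgue)
    then show "(\<lambda>x. D x * (s x * (L\<^sup>2 - x\<^sup>2)\<^sup>2)) \<in> borel_measurable ?M"
      using L2_measurable[OF D] \<open>s \<in> borel_measurable ?M\<close> by measurable
    show "(\<lambda>x. D x * \<eta> n x) \<in> borel_measurable ?M" for n
      using L2_measurable[OF D] L2_measurable[OF L2_test_function(1)[OF \<eta>[of n]]] by measurable
    show "AE x in ?M. (\<lambda>n. D x * \<eta> n x) \<longlonglongrightarrow> D x * (s x * (L\<^sup>2 - x\<^sup>2)\<^sup>2)"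
    proof -
      have "AE x in lebesgue. x \<notin> N"
        using N by (intro AE_not_in) (simp add: negligible_iff_null_sets)
      then have "AE x in ?M. x \<notin> N"
        by (subst AE_restrict_space_iff) auto
      then show ?thesis
      proof (rule AE_mp, intro AE_I2 impI)
        fix x assume x: "x \<in> space ?M" "x \<notin> N"
        have "(\<lambda>n. c' n x) \<longlonglongrightarrow> max (-1) (min 1 (s x))"
          unfolding c'_def using c_lim[OF x(2)] x(1) by (intro tendsto_intros) simp
        moreover have "max (-1) (min 1 (s x)) = s x" by (simp add: s_def sgn_if)
        moreover have "(\<lambda>n. c' n x - p n x) \<longlonglongrightarrow> 0"
          using p_close[of x] x(1)
          by (intro Lim_null_comparison[OF _ LIMSEQ_inverse_real_of_nat])
            (auto simp: inverse_eq_divide intro!: always_eventually less_imp_le)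
        ultimately have "(\<lambda>n. c' n x - (c' n x - p n x)) \<longlonglongrightarrow> s x - 0"
          by (intro tendsto_diff) simp_all
        moreover have "(\<lambda>n. q n x) \<longlonglongrightarrow> (max 0 (L\<^sup>2 - x\<^sup>2))\<^sup>2"
          unfolding q_def by (intro tendsto_intros r_lim)
        moreover have "x\<^sup>2 \<le> L\<^sup>2" using x(1) L by (intro power2_le_iff_abs_le[THEN iffD2]) auto
        ultimately show "(\<lambda>n. D x * \<eta> n x) \<longlonglongrightarrow> D x * (s x * (L\<^sup>2 - x\<^sup>2)\<^sup>2)"
          unfolding \<eta>_def by (intro tendsto_intros) simp_all
      qed
    qed
    show "AE x in ?M. norm (D x * \<eta> n x) \<le> \<bar>D x\<bar> * (2 * (L\<^sup>2)\<^sup>2)" for n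
    proof (rule AE_I2)
      fix x assume x: "x \<in> space ?M"
      have "1 / real (Suc n) \<le> 1" by simp
      moreover have "\<bar>c' n x\<bar> \<le> 1" by (auto simp: c'_def)
      moreover have "\<bar>c' n x - p n x\<bar> < 1 / Suc n" using p_close[of x n] x by simp
      ultimately have "\<bar>p n x\<bar> \<le> 2" by linarith
      moreover have "\<bar>q n x\<bar> \<le> (L\<^sup>2)\<^sup>2"
      proof -
        have "(r n)\<^sup>2 \<le> L\<^sup>2" using r[of n] by (intro power_mono) auto
        then have "max 0 ((r n)\<^sup>2 - x\<^sup>2) \<le> L\<^sup>2"
          by (smt (verit) zero_le_power2)
        then have "(max 0 ((r n)\<^sup>2 - x\<^sup>2))\<^sup>2 \<le> (L\<^sup>2)\<^sup>2"
          by (intro power_mono) auto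
        then show ?thesis unfolding q_def by simp
      qed
      ultimately have "\<bar>\<eta> n x\<bar> \<le> 2 * (L\<^sup>2)\<^sup>2"
        unfolding \<eta>_def abs_mult by (intro mult_mono) auto
      then show "norm (D x * \<eta> n x) \<le> \<bar>D x\<bar> * (2 * (L\<^sup>2)\<^sup>2)"
        by (simp add: abs_mult mult_left_mono)
    qed
  qed
  then have "(LINT x|?M. D x * (s x * (L\<^sup>2 - x\<^sup>2)\<^sup>2)) = 0"
    by (simp add: test[OF \<eta>] LIMSEQ_const_iff)
  moreover have abs_eq: "D x * (s x * (L\<^sup>2 - x\<^sup>2)\<^sup>2) = \<bar>D x\<bar> * (L\<^sup>2 - x\<^sup>2)\<^sup>2" for x
    by (simp add: s_def sgn_if)
  ultimately have "(LINT x|?M. \<bar>D x\<bar> * (L\<^sup>2 - x\<^sup>2)\<^sup>2) = 0" by simp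
  moreover have "integrable ?M (\<lambda>x. \<bar>D x\<bar> * (L\<^sup>2 - x\<^sup>2)\<^sup>2)"
  proof (rule L2_mult_integrable)
    show "(\<lambda>x. \<bar>D x\<bar>) \<in> L2 {-L<..<L}" using D by (auto simp: L2_def)
    show "(\<lambda>x. (L\<^sup>2 - x\<^sup>2)\<^sup>2) \<in> L2 {-L<..<L}"
      by (intro L2_continuous continuous_intros)
  qed
  ultimately have "AE x in ?M. \<bar>D x\<bar> * (L\<^sup>2 - x\<^sup>2)\<^sup>2 = 0"
    by (subst (asm) integral_nonneg_eq_0_iff_AE) auto
  then show ?thesis
  proof (rule AE_mp, intro AE_I2 impI)
    fix x assume "x \<in> space ?M" "\<bar>D x\<bar> * (L\<^sup>2 - x\<^sup>2)\<^sup>2 = 0"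
    moreover from this(1) have "x\<^sup>2 < L\<^sup>2"
      using L power_strict_mono[of "\<bar>x\<bar>" L 2] by (auto simp: abs_less_iff)
    ultimately show "D x = 0" by auto
  qed
qed

section \<open>From almost everywhere identities to pointwise values\<close>

lemma AE_lebesgue_on_imp_ex:
  fixes a b c d :: real
  assumes "AE x in lebesgue_on {a<..<b}. P x" "a \<le> c" "c < d" "d \<le> b"
  obtains x where "x \<in> {c<..<d}" "P x"
proof -
  have "AE x in lebesgue. x \<in> {a<..<b} \<longrightarrow> P x"
    using assms(1) by (subst (asm) AE_restrict_space_iff) auto
  then obtain N where N: "\<And>x. x \<in> space lebesgue - N \<Longrightarrow> x \<in> {a<..<b} \<longrightarrow> P x" "N \<in> null_sets lebesgue"
    by (rule AE_E3) blast
  have "\<not> {c<..<d} \<subseteq> N"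
  proof
    assume "{c<..<d} \<subseteq> N"
    then have "negligible (box c d)"
      using N(2) by (metis box_real(1) negligible_iff_null_sets negligible_subset)
    then have "box c d = {}" by (simp only: negligible_interval)
    then show False using \<open>c < d\<close> by simp
  qed
  then show thesis using N(1) assms(2,4) that by fastforce
qed

lemma tendsto_at_left_AE_unique:
  fixes v v' :: "real \<Rightarrow> real"
  assumes eq: "AE x in lebesgue_on {a<..<b}. v x = v' x" and c: "a < c" "c \<le> b"
    and lims: "(v \<longlongrightarrow> l) (at_left c)" "(v' \<longlongrightarrow> l') (at_left c)"
  shows "l = l'"
proof (rule ccontr)
  assume "l \<noteq> l'"
  then have "l - l' \<noteq> 0" by simp
  then have "\<forall>\<^sub>F x in at_left c. v x - v' x \<noteq> 0"
    using tendsto_diff[OF lims] by (rule tendsto_imp_eventually_ne[rotated])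
  then obtain d where d: "d < c" "\<And>x. d < x \<Longrightarrow> x < c \<Longrightarrow> v x - v' x \<noteq> 0"
    unfolding eventually_at_left[OF c(1)] by auto
  obtain x where "x \<in> {max a d<..<c}" "v x = v' x"
    using AE_lebesgue_on_imp_ex[OF eq, of "max a d" c] c d(1) by auto
  then show False using d(2)[of x] by simp
qed

text \<open>Two identifications are needed. \<open>H1_0\<close> provides its own weak derivative
  \<open>g0\<close>, equal to \<open>g\<close> a.e. by the fundamental lemma; and the test functions
  converge uniformly to a primitive of \<open>g\<close>, which has to be recognised as the given
  continuous \<phi>.\<close>

lemma H1_0_approximable:
  assumes L: "L > 0" and \<phi>: "\<phi> \<in> H1_0 {-L<..<L}" and cont: "continuous_on {-L..L} \<phi>"
    and g: "has_weak_derivative {-L<..<L} \<phi> g"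
  shows "H1_approximable {-L<..<L} \<phi> g"
proof -
  let ?M = "lebesgue_on {-L<..<L}"
  obtain g0 \<eta> where g0: "has_weak_derivative {-L<..<L} \<phi> g0"
    and \<eta>: "\<And>n::nat. \<eta> n \<in> test_functions {-L<..<L}"
    and lim: "(\<lambda>n. L2_norm {-L<..<L} (\<lambda>x. \<eta> n x - \<phi> x)) \<longlonglongrightarrow> 0"
    and lim': "(\<lambda>n. L2_norm {-L<..<L} (\<lambda>x. deriv (\<eta> n) x - g0 x)) \<longlonglongrightarrow> 0"
    using \<phi> unfolding H1_0_def by blast
  have g_L2: "g \<in> L2 {-L<..<L}" and g0_L2: "g0 \<in> L2 {-L<..<L}" and \<phi>_L2: "\<phi> \<in> L2 {-L<..<L}"
    using g g0 by (auto simp: has_weak_derivative_def)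
  have "AE x in ?M. g0 x - g x = 0"
  proof (rule integral_test_functions_eq_0_imp_AE_eq_0[OF L L2_diff[OF g0_L2 g_L2]])
    fix \<xi> assume \<xi>: "\<xi> \<in> test_functions {-L<..<L}"
    have "(LINT x|?M. g0 x * \<xi> x) = (LINT x|?M. g x * \<xi> x)"
      using g g0 \<xi> unfolding has_weak_derivative_def by force
    then show "(LINT x|?M. (g0 x - g x) * \<xi> x) = 0"
      using L2_mult_integrable[OF g0_L2 L2_test_function(1)[OF \<xi>]]
        L2_mult_integrable[OF g_L2 L2_test_function(1)[OF \<xi>]] by (simp add: left_diff_distrib)
  qed
  then have AE_g: "AE x in ?M. g0 x = g x" by (rule AE_mp) auto
  have "L2_norm {-L<..<L} (\<lambda>x. deriv (\<eta> n) x - g0 x) = L2_norm {-L<..<L} (\<lambda>x. deriv (\<eta> n) x - g x)" for n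
  proof -
    note [measurable] = L2_measurable[OF g_L2] L2_measurable[OF g0_L2]
      L2_measurable[OF L2_test_function(2)[OF \<eta>[of n]]]
    have "(LINT x|?M. (deriv (\<eta> n) x - g0 x)\<^sup>2) = (LINT x|?M. (deriv (\<eta> n) x - g x)\<^sup>2)"
    proof (rule integral_cong_AE)
      show "AE x in ?M. (deriv (\<eta> n) x - g0 x)\<^sup>2 = (deriv (\<eta> n) x - g x)\<^sup>2"
        using AE_g by (rule AE_mp) auto
    qed measurable
    then show ?thesis by (simp add: L2_norm_def)
  qed
  with lim' have lim_g: "(\<lambda>n. L2_norm {-L<..<L} (\<lambda>x. deriv (\<eta> n) x - g x)) \<longlonglongrightarrow> 0" by simp
  define \<psi> where "\<psi> x = (LINT t|?M. indicator {..<x} t * g t)" for x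
  have unif: "uniform_limit {-L<..<L} \<eta> \<psi> sequentially"
    unfolding \<psi>_def by (rule test_functions_uniform_limit[OF \<eta> g_L2 lim_g])
  have \<psi>_cont: "continuous_on {-L<..<L} \<psi>"
    by (rule uniform_limit_theorem[OF _ unif])
      (auto intro!: always_eventually test_function_continuous[OF \<eta>])
  have "bounded (\<psi> ` {-L<..<L})"
    by (rule uniform_limit_bounded[OF unif])
      (auto intro!: always_eventually bounded_subset[OF test_function_bounded[OF \<eta>]])
  then obtain B where B: "\<forall>y\<in>\<psi> ` {-L<..<L}. norm y \<le> B"
    unfolding bounded_iff by blast
  have \<psi>_L2: "\<psi> \<in> L2 {-L<..<L}"
    using B by (intro L2_bounded[where B = B] continuous_imp_measurable_on_sets_lebesgue \<psi>_cont) auto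
  have U: "(\<lambda>x. \<psi> x - \<phi> x) \<in> L2 {-L<..<L}" by (rule L2_diff[OF \<psi>_L2 \<phi>_L2])
  \<comment> \<open>The difference \<psi> - \<phi> is paired with \<eta> n - \<phi>: L2 convergence
    of \<eta> n to \<phi> gives the limit 0, uniform convergence to \<psi> gives the square integral
    of \<psi> - \<phi>.\<close>
  have "(LINT x|?M. (\<psi> x - \<phi> x)\<^sup>2) = 0"
  proof -
    let ?C = "((LINT x|?M. (\<psi> x - \<phi> x)\<^sup>2) + 1) / 2"
    have "(\<lambda>n. LINT x|?M. (\<psi> x - \<phi> x) * (\<eta> n x - \<phi> x)) \<longlonglongrightarrow> 0"
    proof (rule Lim_null_comparison)
      show "(\<lambda>n. ?C * L2_norm {-L<..<L} (\<lambda>x. \<eta> n x - \<phi> x)) \<longlonglongrightarrow> 0"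
        using tendsto_mult_left[OF lim, of ?C] by simp
      show "\<forall>\<^sub>F n in sequentially. norm (LINT x|?M. (\<psi> x - \<phi> x) * (\<eta> n x - \<phi> x))
          \<le> ?C * L2_norm {-L<..<L} (\<lambda>x. \<eta> n x - \<phi> x)"
        unfolding real_norm_def
        by (intro always_eventually allI L2_pairing_bound[OF U] L2_diff L2_test_function(1) \<eta> \<phi>_L2)
    qed
    moreover have "(\<lambda>n. LINT x|?M. (\<psi> x - \<phi> x) * (\<eta> n x - \<phi> x)) \<longlonglongrightarrow> (LINT x|?M. (\<psi> x - \<phi> x)\<^sup>2)"
    proof -
      have "(\<lambda>n. LINT x|?M. \<eta> n x * (\<psi> x - \<phi> x)) \<longlonglongrightarrow> (LINT x|?M. \<psi> x * (\<psi> x - \<phi> x))"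
        using unif
        by (intro uniform_limit_integral_mult(2) L2_integrable[OF U] L2_measurable L2_test_function(1) \<eta>
            bounded_subset[OF test_function_bounded[OF \<eta>]]) auto
      then have "(\<lambda>n. (LINT x|?M. \<eta> n x * (\<psi> x - \<phi> x)) - (LINT x|?M. \<phi> x * (\<psi> x - \<phi> x)))
          \<longlonglongrightarrow> (LINT x|?M. \<psi> x * (\<psi> x - \<phi> x)) - (LINT x|?M. \<phi> x * (\<psi> x - \<phi> x))"
        by (intro tendsto_intros)
      moreover have "(LINT x|?M. \<xi> x * (\<psi> x - \<phi> x)) - (LINT x|?M. \<phi> x * (\<psi> x - \<phi> x))
          = (LINT x|?M. (\<psi> x - \<phi> x) * (\<xi> x - \<phi> x))" if "\<xi> \<in> L2 {-L<..<L}" for \<xi>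
        using L2_mult_integrable[OF that U] L2_mult_integrable[OF \<phi>_L2 U]
        by (subst Bochner_Integration.integral_diff[symmetric]) (auto simp: algebra_simps intro!: Bochner_Integration.integral_cong)
      ultimately show ?thesis
        using L2_test_function(1)[OF \<eta>] \<psi>_L2 by (simp add: power2_eq_square)
    qed
    ultimately show ?thesis using LIMSEQ_unique by blast
  qed
  then have "AE x in ?M. (\<psi> x - \<phi> x)\<^sup>2 = 0"
    using L2_integrable_square[OF U] by (subst (asm) integral_nonneg_eq_0_iff_AE) auto
  then have AE_eq: "AE x in ?M. \<psi> x = \<phi> x" by (rule AE_mp) auto
  have eq: "\<psi> x = \<phi> x" if "x \<in> {-L<..<L}" for x
  proof (rule tendsto_at_left_AE_unique[OF AE_eq])
    have "isCont \<psi> x"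
      using \<psi>_cont that by (simp add: continuous_on_eq_continuous_at)
    then show "(\<psi> \<longlongrightarrow> \<psi> x) (at_left x)"
      using isCont_def filterlim_at_split by blast
    have "continuous_on {-L<..<L} \<phi>" by (rule continuous_on_subset[OF cont]) auto
    then have "isCont \<phi> x"
      using that by (simp add: continuous_on_eq_continuous_at)
    then show "(\<phi> \<longlongrightarrow> \<phi> x) (at_left x)"
      using isCont_def filterlim_at_split by blast
  qed (use that in auto)
  have "uniform_limit {-L<..<L} \<eta> \<phi> sequentially"
    using unif by (rule uniform_limit_cong'[THEN iffD1, rotated -1]) (auto simp: eq)
  then show ?thesis
    unfolding H1_approximable_def using g_L2 \<eta> lim_g by blast
qed

subsection \<open>Piecewise smooth functions\<close>

lemma has_real_derivative_compose_abs:
  fixes F :: "real \<Rightarrow> real"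
  assumes F: "\<And>x. (F has_real_derivative F' x) (at x)" and "x \<noteq> 0"
  shows "((\<lambda>x. F \<bar>x\<bar>) has_real_derivative sgn x * F' \<bar>x\<bar>) (at x)"
proof (cases "x > 0")
  case True
  have "(F has_real_derivative sgn x * F' \<bar>x\<bar>) (at x)" using F[of x] True by simp
  then show ?thesis
    by (rule has_field_derivative_transform_within_open[of _ _ _ "{0<..}"]) (use True in auto)
next
  case False
  have "((\<lambda>x. F (- x)) has_real_derivative sgn x * F' \<bar>x\<bar>) (at x)"
    using DERIV_mirror[THEN iffD1, OF F[of "- x"]] False assms(2) by simp
  then show ?thesis
    by (rule has_field_derivative_transform_within_open[of _ _ _ "{..<0}"]) (use False assms(2) in auto)
qed

lemma has_real_derivative_odd_imp_even:
  fixes G :: "real \<Rightarrow> real"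
  assumes G: "\<And>x. (G has_real_derivative g x) (at x)" and odd: "\<And>x. g (- x) = - g x"
  shows "G (- x) = G x"
proof -
  have "((\<lambda>x. G x - G (- x)) has_real_derivative 0) (at x)" for x
    using DERIV_diff[OF G[of x] DERIV_mirror[THEN iffD1, OF G[of "- x"]]] odd[of x] by simp
  then have "(\<lambda>x. G x - G (- x)) x = (\<lambda>x. G x - G (- x)) 0"
    by (intro DERIV_isconst_all allI)
  then show ?thesis by simp
qed

text \<open>Multiplying the odd derivative by even cutoffs keeps its integral zero, so that its primitive
  has compact support.\<close>

lemma H1_approximable_even:
  fixes q F :: "real \<Rightarrow> real"
  assumes L: "L > 0" and q: "continuous_on UNIV q"
    and F: "\<And>x. (F has_real_derivative q x) (at x)"
  shows "H1_approximable {-L<..<L} (\<lambda>x. F L - F \<bar>x\<bar>) (\<lambda>x. - (sgn x * q \<bar>x\<bar>))"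
proof -
  let ?M = "lebesgue_on {-L<..<L}"
  interpret finite_measure ?M by (rule finite_measure_interval)
  define g where "g x = - (sgn x * q \<bar>x\<bar>)" for x
  have q_abs: "continuous_on S (\<lambda>x. q \<bar>x\<bar>)" for S
    by (intro continuous_on_compose2[OF q] continuous_intros) auto
  have "bounded (q ` {0..L})"
    by (intro compact_imp_bounded compact_continuous_image continuous_on_subset[OF q]) auto
  then obtain B where B: "\<forall>y\<in>q ` {0..L}. norm y \<le> B"
    unfolding bounded_iff by blast
  have qB: "\<bar>q \<bar>x\<bar>\<bar> \<le> B" if "x \<in> {-L<..<L}" for x using B that by auto
  have "(\<lambda>x. q \<bar>x\<bar>) \<in> borel_measurable ?M"
    by (intro continuous_imp_measurable_on_sets_lebesgue q_abs) simp
  moreover have "(\<lambda>x::real. x) \<in> borel_measurable ?M"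
    by (intro continuous_imp_measurable_on_sets_lebesgue) auto
  ultimately have g_meas: "g \<in> borel_measurable ?M"
    unfolding g_def[abs_def] by measurable
  have gB: "\<bar>g x\<bar> \<le> B" if "x \<in> {-L<..<L}" for x
    using qB[OF that] by (auto simp: g_def abs_mult sgn_if)
  have g_L2: "g \<in> L2 {-L<..<L}" by (rule L2_bounded[OF g_meas gB])
  \<comment> \<open>\<open>s n\<close> is an odd continuous approximation of sgn with slope n at 0.
    \<open>z n\<close> is an even cutoff, 0 within distance 1 / Suc n of the endpoints and 1 from
    distance 2 / Suc n on.\<close>
  define s where "s n x = max (-1) (min 1 (real n * x))" for n x
  define z where "z n x = max 0 (min 1 (real (Suc n) * (L - \<bar>x\<bar>) - 1))" for n x
  define gn where "gn n x = - (s n x * q \<bar>x\<bar> * z n x)" for n x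
  have gn_cont: "continuous_on S (gn n)" for n S
    unfolding gn_def[abs_def] s_def z_def by (intro continuous_intros q_abs)
  have gn_odd: "gn n (- x) = - gn n x" for n x
    unfolding gn_def s_def z_def by (simp add: max_def min_def)
  have "\<exists>G. \<forall>x. (G has_real_derivative gn n x) (at x)" for n
    using einterval_antiderivative[of "-\<infinity>" "\<infinity>" "gn n"] gn_cont[of UNIV n]
    by (auto simp: has_real_derivative_iff_has_vector_derivative continuous_on_eq_continuous_at)
  then obtain G where G: "\<And>n x. (G n has_real_derivative gn n x) (at x)" by metis
  have G_even: "G n (- x) = G n x" for n x
    by (rule has_real_derivative_odd_imp_even[OF G gn_odd])
  define r where "r n = max 0 (L - 1 / real (Suc n))" for n
  have r: "0 \<le> r n" "r n < L" for n using L by (auto simp: r_def)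
  have G_const: "G n x = G n L" if "x \<ge> r n" for n x
  proof -
    have zero: "gn n y = 0" if "y > r n" for y
    proof -
      have "L - y < 1 / real (Suc n)" "\<bar>y\<bar> = y" using that by (auto simp: r_def)
      then have "real (Suc n) * (L - \<bar>y\<bar>) - 1 \<le> 0" by (simp add: field_simps)
      then show ?thesis by (simp add: gn_def z_def)
    qed
    have const: "G n y = G n (r n)" if "y \<ge> r n" for y
    proof (rule DERIV_isconst2[where f = "G n" and a = "r n" and b = "y + 1"])
      show "continuous_on {r n..y + 1} (G n)"
        using G by (meson DERIV_isCont continuous_at_imp_continuous_on)
      show "(G n has_real_derivative 0) (at t)" if "r n < t" for t
        using G[of n t] zero[OF that] by simp
    qed (use that in auto)
    show ?thesis using const[OF that] const[of L] r(2)[of n] by simp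
  qed
  define \<eta> where "\<eta> n x = G n x - G n L" for n x
  have \<eta>_deriv: "(\<eta> n has_real_derivative gn n x) (at x)" for n x
    unfolding \<eta>_def[abs_def] using DERIV_diff[OF G DERIV_const] by simp
  have \<eta>: "\<eta> n \<in> test_functions {-L<..<L}" for n
  proof (rule test_functionI[OF \<eta>_deriv[of n] gn_cont, of "- r n" "r n"])
    show "\<eta> n x = 0" if "x \<notin> {- r n..r n}" for x
    proof (cases "x \<ge> r n")
      case True then show ?thesis by (simp add: \<eta>_def G_const)
    next
      case False
      then have "- x \<ge> r n" using that by auto
      then show ?thesis using G_const[of n "- x"] by (simp add: \<eta>_def G_even)
    qed
    show "{- r n..r n} \<subseteq> {-L<..<L}" using r[of n] by auto
  qed
  have deriv_\<eta>: "deriv (\<eta> n) = gn n" for n using \<eta>_deriv DERIV_imp_deriv by blast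
  have "(\<lambda>n. LINT x|?M. (gn n x - g x)\<^sup>2) \<longlonglongrightarrow> (LINT x|?M. 0)"
  proof (rule integral_dominated_convergence)
    show "integrable ?M (\<lambda>x. (2 * B)\<^sup>2)" by simp
    show "(\<lambda>x. 0) \<in> borel_measurable ?M" by simp
    have "gn n \<in> borel_measurable ?M" for n
      by (intro continuous_imp_measurable_on_sets_lebesgue gn_cont) simp
    then show "(\<lambda>x. (gn n x - g x)\<^sup>2) \<in> borel_measurable ?M" for n
      using g_meas by measurable
    show "AE x in ?M. (\<lambda>n. (gn n x - g x)\<^sup>2) \<longlonglongrightarrow> 0"
    proof (rule AE_I2)
      fix x assume x: "x \<in> space ?M"
      have top: "filterlim (\<lambda>n. real n * c) at_top sequentially" if "c > 0" for c :: real
        using that by (intro filterlim_at_top_mult_tendsto_pos[OF tendsto_const _ filterlim_real_sequentially])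
      have "\<forall>\<^sub>F n in sequentially. s n x = sgn x"
      proof (cases "x = 0")
        case True then show ?thesis by (simp add: s_def)
      next
        case False
        then have "\<forall>\<^sub>F n in sequentially. 1 \<le> real n * \<bar>x\<bar>"
          using top[of "\<bar>x\<bar>"] by (simp add: filterlim_at_top)
        then show ?thesis
          by eventually_elim (auto simp: s_def sgn_if abs_if split: if_splits)
      qed
      moreover have "\<forall>\<^sub>F n in sequentially. z n x = 1"
      proof -
        have "L - \<bar>x\<bar> > 0" using x by auto
        then have "\<forall>\<^sub>F n in sequentially. 2 \<le> real n * (L - \<bar>x\<bar>)"
          using top[of "L - \<bar>x\<bar>"] by (simp add: filterlim_at_top)
        then show ?thesis
        proof eventually_elim
          fix n assume "2 \<le> real n * (L - \<bar>x\<bar>)"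
          moreover have "real n * (L - \<bar>x\<bar>) \<le> real (Suc n) * (L - \<bar>x\<bar>)"
            using \<open>L - \<bar>x\<bar> > 0\<close> by (intro mult_right_mono) auto
          ultimately show "z n x = 1" by (simp add: z_def)
        qed
      qed
      ultimately have "\<forall>\<^sub>F n in sequentially. (gn n x - g x)\<^sup>2 = 0"
        by eventually_elim (simp add: gn_def g_def)
      then show "(\<lambda>n. (gn n x - g x)\<^sup>2) \<longlonglongrightarrow> 0" by (rule tendsto_eventually)
    qed
    show "AE x in ?M. norm ((gn n x - g x)\<^sup>2) \<le> (2 * B)\<^sup>2" for n
    proof (rule AE_I2)
      fix x assume x: "x \<in> space ?M"
      have "\<bar>s n x * z n x\<bar> \<le> 1 * 1"
        unfolding abs_mult by (intro mult_mono) (auto simp: s_def z_def)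
      then have "\<bar>s n x * z n x\<bar> * \<bar>q \<bar>x\<bar>\<bar> \<le> 1 * B"
        using qB[of x] x by (intro mult_mono) auto
      then have "\<bar>gn n x\<bar> \<le> B" by (simp add: gn_def abs_mult mult.commute mult.left_commute)
      then have "\<bar>gn n x - g x\<bar> \<le> 2 * B" using gB[of x] x by simp
      then have "\<bar>gn n x - g x\<bar>\<^sup>2 \<le> (2 * B)\<^sup>2" by (intro power_mono) auto
      then show "norm ((gn n x - g x)\<^sup>2) \<le> (2 * B)\<^sup>2" by simp
    qed
  qed
  then have "(\<lambda>n. sqrt (LINT x|?M. (gn n x - g x)\<^sup>2)) \<longlonglongrightarrow> sqrt 0"
    by (intro tendsto_real_sqrt) simp
  then have lim: "(\<lambda>n. L2_norm {-L<..<L} (\<lambda>x. deriv (\<eta> n) x - g x)) \<longlonglongrightarrow> 0"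
    by (simp add: L2_norm_def deriv_\<eta>)
  have unif: "uniform_limit {-L<..<L} \<eta> (\<lambda>x. LINT t|?M. indicator {..<x} t * g t) sequentially"
    by (rule test_functions_uniform_limit[OF \<eta> g_L2 lim])
  \<comment> \<open>The limit is the primitive of \<open>g\<close> vanishing at -L; so is F L - F
    \<bar>x\<bar>, whose kink at 0 is the exceptional point.\<close>
  have integral_eq: "(LINT t|?M. indicator {..<x} t * g t) = F L - F \<bar>x\<bar>" if x: "x \<in> {-L<..<L}" for x
  proof -
    have "(LINT t|lebesgue_on {-L<..<x}. g t) = (F L - F \<bar>x\<bar>) - (F L - F \<bar>-L\<bar>)"
    proof (rule integral_lebesgue_on_FTC[where S = "{0}"])
      show "((\<lambda>t. F L - F \<bar>t\<bar>) has_real_derivative g t) (at t)" if "t \<in> {- L<..<x} - {0}" for t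
        using DERIV_diff[OF DERIV_const has_real_derivative_compose_abs[OF F, of t]] that
        by (simp add: g_def)
      have F_cont: "continuous_on UNIV F"
        using F by (meson DERIV_isCont continuous_at_imp_continuous_on)
      have "continuous_on {-L..x} (\<lambda>t. F \<bar>t\<bar>)"
        by (rule continuous_on_compose2[OF F_cont]) (auto intro!: continuous_intros)
      then show "continuous_on {-L..x} (\<lambda>t. F L - F \<bar>t\<bar>)"
        by (intro continuous_on_diff continuous_on_const)
      have "g \<in> borel_measurable (lebesgue_on {-L<..<x})"
        by (rule measurable_restrict_mono[OF g_meas]) (use x in auto)
      then show "integrable (lebesgue_on {-L<..<x}) g"
        by (intro L2_integrable L2_bounded[where B = B] gB) (use x in auto)
    qed (use x in auto)
    then show ?thesis using L by (simp add: integral_indicator_lessThan[OF x])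
  qed
  have "uniform_limit {-L<..<L} \<eta> (\<lambda>x. F L - F \<bar>x\<bar>) sequentially"
    using unif by (rule uniform_limit_cong'[THEN iffD1, rotated -1]) (auto simp: integral_eq)
  then show ?thesis
    unfolding H1_approximable_def g_def[symmetric] using g_L2 \<eta> lim by blast
qed

text \<open>This shape covers both the candidate v and, with q = 0, the datum f.\<close>

lemma jump_function_L2:
  fixes q :: "real \<Rightarrow> real"
  assumes "continuous_on UNIV q"
  shows "(\<lambda>x. if x \<le> 0 then q \<bar>x\<bar> else h - q \<bar>x\<bar>) \<in> L2 {-L<..<L}"
proof -
  let ?M = "lebesgue_on {-L<..<L}"
  have q_abs: "continuous_on S (\<lambda>x. q \<bar>x\<bar>)" for S
    by (intro continuous_on_compose2[OF assms] continuous_intros) auto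
  have "bounded ((\<lambda>x. q \<bar>x\<bar>) ` {-L..L})"
    by (intro compact_imp_bounded compact_continuous_image q_abs compact_Icc)
  then obtain B where B: "\<forall>y\<in>(\<lambda>x. q \<bar>x\<bar>) ` {-L..L}. norm y \<le> B"
    unfolding bounded_iff by blast
  have B': "\<bar>q \<bar>x\<bar>\<bar> \<le> B" if "x \<in> {-L<..<L}" for x using B that by auto
  have [measurable]: "(\<lambda>x. q \<bar>x\<bar>) \<in> borel_measurable ?M"
    by (intro continuous_imp_measurable_on_sets_lebesgue q_abs) simp
  have [measurable]: "(\<lambda>x::real. x) \<in> borel_measurable ?M"
    by (intro continuous_imp_measurable_on_sets_lebesgue) auto
  show ?thesis
  proof (rule L2_bounded)
    show "(\<lambda>x. if x \<le> 0 then q \<bar>x\<bar> else h - q \<bar>x\<bar>) \<in> borel_measurable ?M" by measurable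
    show "\<bar>if x \<le> 0 then q \<bar>x\<bar> else h - q \<bar>x\<bar>\<bar> \<le> \<bar>h\<bar> + B" if "x \<in> {-L<..<L}" for x
      using B'[OF that] by auto
  qed
qed

text \<open>Both branches have the classical derivative - q' \<bar>x\<bar>, and the right limit at 0
  exceeds the left one by h - 2 q(0). So the distributional derivative is that density plus this
  multiple of the Dirac mass at 0.\<close>

lemma jump_function_weak_derivative:
  fixes q q' :: "real \<Rightarrow> real" and h :: real
  assumes L: "L > 0" and q: "\<And>x. (q has_real_derivative q' x) (at x)" and q': "continuous_on UNIV q'"
    and \<eta>: "\<eta> \<in> test_functions {-L<..<L}"
  defines "u \<equiv> (\<lambda>x. if x \<le> 0 then q \<bar>x\<bar> else h - q \<bar>x\<bar>)"
  shows "(LINT x|lebesgue_on {-L<..<L}. u x * deriv \<eta> x)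
      = (LINT x|lebesgue_on {-L<..<L}. q' \<bar>x\<bar> * \<eta> x) - (h - 2 * q 0) * \<eta> 0"
proof -
  let ?M = "lebesgue_on {-L<..<L}"
  have q_cont: "continuous_on S q" for S
    using q by (meson DERIV_isCont continuous_at_imp_continuous_on)
  have q_abs: "continuous_on S (\<lambda>x. q \<bar>x\<bar>)" for S
    by (intro continuous_on_compose2[OF q_cont[of UNIV]] continuous_intros) auto
  have q'_abs: "continuous_on S (\<lambda>x. q' \<bar>x\<bar>)" for S
    by (intro continuous_on_compose2[OF q'] continuous_intros) auto
  have q'_L2: "(\<lambda>x. q' \<bar>x\<bar>) \<in> L2 {-L<..<L}" by (rule L2_continuous[OF q'_abs])
  have u_L2: "u \<in> L2 {-L<..<L}" unfolding u_def by (rule jump_function_L2[OF q_cont])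
  \<comment> \<open>The jump is split off as a multiple of the Heaviside function. Since \<eta> (max
    x 0) is a continuous primitive of Heaviside times \<eta>', the sum \<open>H\<close> is
    continuous at 0 and the fundamental theorem applies across the jump. The value of \<eta> (max x
    0) at -L produces the term \<eta> 0.\<close>
  define H where "H x = (if x \<le> 0 then q \<bar>x\<bar> else 2 * q 0 - q \<bar>x\<bar>) * \<eta> x + (h - 2 * q 0) * \<eta> (max x 0)" for x
  have "(LINT x|?M. u x * deriv \<eta> x - q' \<bar>x\<bar> * \<eta> x) = H L - H (-L)"
  proof (rule integral_lebesgue_on_FTC[where S = "{0}"])
    show "(H has_real_derivative u x * deriv \<eta> x - q' \<bar>x\<bar> * \<eta> x) (at x)"
      if "x \<in> {-L<..<L} - {0}" for x
    proof (cases "x > 0")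
      case True
      have "((\<lambda>x. (2 * q 0 - q x) * \<eta> x + (h - 2 * q 0) * \<eta> x) has_real_derivative
          u x * deriv \<eta> x - q' \<bar>x\<bar> * \<eta> x) (at x)"
        using True by (auto intro!: derivative_eq_intros q test_function_deriv[OF \<eta>] simp: u_def algebra_simps)
      then show ?thesis
        by (rule has_field_derivative_transform_within_open[of _ _ _ "{0<..}"])
          (use True in \<open>auto simp: H_def max_def\<close>)
    next
      case False
      then have neg: "x < 0" using that by auto
      have "((\<lambda>x. q (- x)) has_real_derivative - q' (- x)) (at x)"
        using DERIV_mirror[THEN iffD1, OF q] .
      then have "((\<lambda>x. q (- x) * \<eta> x + (h - 2 * q 0) * \<eta> 0) has_real_derivative
          u x * deriv \<eta> x - q' \<bar>x\<bar> * \<eta> x) (at x)"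
        using neg by (auto intro!: derivative_eq_intros test_function_deriv[OF \<eta>] simp: u_def algebra_simps)
      then show ?thesis
        by (rule has_field_derivative_transform_within_open[of _ _ _ "{..<0}"])
          (use neg in \<open>auto simp: H_def max_def\<close>)
    qed
    have "continuous_on ({-L..L} \<inter> {x. x \<le> 0} \<union> {-L..L} \<inter> {x. x \<ge> 0}) (\<lambda>x. if x \<le> 0 then q \<bar>x\<bar> else 2 * q 0 - q \<bar>x\<bar>)"
      by (intro continuous_on_If closed_Int closed_Collect_le continuous_intros q_abs) auto
    moreover have "{-L..L} \<inter> {x. x \<le> 0} \<union> {-L..L} \<inter> {x. x \<ge> 0} = {-L..L}" by auto
    ultimately have "continuous_on {-L..L} (\<lambda>x. if x \<le> 0 then q \<bar>x\<bar> else 2 * q 0 - q \<bar>x\<bar>)"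
      by simp
    then show "continuous_on {-L..L} H"
      unfolding H_def
      by (intro continuous_intros test_function_continuous[OF \<eta>]
          continuous_on_compose2[OF test_function_continuous[OF \<eta>, of UNIV]]) auto
    show "integrable ?M (\<lambda>x. u x * deriv \<eta> x - q' \<bar>x\<bar> * \<eta> x)"
      by (intro Bochner_Integration.integrable_diff L2_mult_integrable u_L2 q'_L2 L2_test_function \<eta>)
  qed (use L in auto)
  moreover have "\<eta> L = 0" "\<eta> (-L) = 0" by (auto intro!: test_function_outside[OF \<eta>])
  ultimately have "(LINT x|?M. u x * deriv \<eta> x - q' \<bar>x\<bar> * \<eta> x) = - ((h - 2 * q 0) * \<eta> 0)"
    using L by (simp add: H_def max_def)
  moreover have "(LINT x|?M. u x * deriv \<eta> x - q' \<bar>x\<bar> * \<eta> x)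
      = (LINT x|?M. u x * deriv \<eta> x) - (LINT x|?M. q' \<bar>x\<bar> * \<eta> x)"
    by (intro Bochner_Integration.integral_diff L2_mult_integrable u_L2 q'_L2 L2_test_function \<eta>)
  ultimately show ?thesis by simp
qed

subsection \<open>Signed measures\<close>

lemma
  assumes "\<Omega> \<in> sets borel"
  shows space_variation_measure: "space (variation_measure \<Omega> \<mu>) = \<Omega>"
    and sets_variation_measure: "sets (variation_measure \<Omega> \<mu>) = borel_sets \<Omega>"
proof -
  have sub: "borel_sets \<Omega> \<subseteq> Pow \<Omega>"
    using sets.space_closed[of "restrict_space borel \<Omega>"] by (simp add: space_restrict_space)
  then show "space (variation_measure \<Omega> \<mu>) = \<Omega>"
    by (simp add: variation_measure_def space_measure_of)
  show "sets (variation_measure \<Omega> \<mu>) = borel_sets \<Omega>"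
    using sets.sigma_sets_eq[of "restrict_space borel \<Omega>"] sub
    by (simp add: variation_measure_def sets_measure_of space_restrict_space)
qed

text \<open>If \<^term>\<open>variation \<Omega> \<mu>\<close> is not a measure then \<^const>\<open>measure_of\<close> is the null measure, so
  only the total variation matters.\<close>

lemma finite_measure_variation_measure:
  assumes "\<Omega> \<in> sets borel" "variation \<Omega> \<mu> \<Omega> < \<infinity>"
  shows "finite_measure (variation_measure \<Omega> \<mu>)"
proof (rule finite_measureI)
  have "emeasure (variation_measure \<Omega> \<mu>) \<Omega> \<le> variation \<Omega> \<mu> \<Omega>"
    by (simp add: variation_measure_def emeasure_measure_of_conv)
  then show "emeasure (variation_measure \<Omega> \<mu>) (space (variation_measure \<Omega> \<mu>)) \<noteq> \<infinity>"
    using assms by (auto simp: space_variation_measure top.not_eq_extremum[symmetric] top_unique)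
qed

lemma set_integral_lebesgue_on:
  fixes w :: "real \<Rightarrow> real"
  assumes "\<Omega> \<in> sets borel" "A \<subseteq> \<Omega>"
  shows "(LINT x:A|lebesgue. w x) = (LINT x|lebesgue_on \<Omega>. indicator A x * w x)"
proof -
  have "(LINT x|lebesgue_on \<Omega>. indicator A x * w x)
      = (LINT x|lebesgue. indicator \<Omega> x *\<^sub>R (indicator A x * w x))"
    using assms(1) by (intro integral_restrict_space) simp
  also have "\<dots> = (LINT x:A|lebesgue. w x)"
    unfolding set_lebesgue_integral_def
    using assms(2) by (intro Bochner_Integration.integral_cong) (auto simp: indicator_def)
  finally show ?thesis by simp
qed

lemma borel_sets_subset_lebesgue_on: "borel_sets \<Omega> \<subseteq> sets (lebesgue_on \<Omega>)"
proof -
  have "sets (borel :: real measure) \<subseteq> sets lebesgue" by auto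
  then show ?thesis unfolding sets_restrict_space by (rule image_mono)
qed

lemma borel_measurable_lebesgue_on_restrict:
  fixes \<eta> :: "real \<Rightarrow> real"
  assumes "\<eta> \<in> borel_measurable (restrict_space borel \<Omega>)"
  shows "\<eta> \<in> borel_measurable (lebesgue_on \<Omega>)"
proof (rule measurableI)
  fix S :: "real set" assume "S \<in> sets borel"
  then have "\<eta> -` S \<inter> \<Omega> \<in> borel_sets \<Omega>"
    using measurable_sets[OF assms, of S] by (simp add: space_restrict_space)
  then have "\<eta> -` S \<inter> \<Omega> \<in> sets (lebesgue_on \<Omega>)"
    using borel_sets_subset_lebesgue_on by (rule subsetD[rotated])
  then show "\<eta> -` S \<inter> space (lebesgue_on \<Omega>) \<in> sets (lebesgue_on \<Omega>)" by simp
qed simp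

text \<open>On each piece of a partition the density contributes at most the mass of the measure
  \<open>N\<close> with density \<bar>w\<bar>. As \<open>N\<close> is additive, these contributions
  add up to the L1 norm of w for every partition. Applied to Du, this makes the variation measure of
  Du - w finite.\<close>

lemma variation_minus_density_finite:
  assumes \<Omega>: "\<Omega> \<in> sets borel" and \<nu>: "variation \<Omega> \<nu> \<Omega> < \<infinity>" and w: "integrable (lebesgue_on \<Omega>) w"
  shows "variation \<Omega> (\<lambda>A. \<nu> A - (LINT x:A|lebesgue. w x)) \<Omega> < \<infinity>"
proof -
  let ?M = "lebesgue_on \<Omega>"
  define N where "N = density ?M (\<lambda>x. ennreal \<bar>w x\<bar>)"
  have [measurable]: "w \<in> borel_measurable ?M" using w by simp
  have meas: "B \<in> sets ?M" if "B \<in> borel_sets \<Omega>" for B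
    using that borel_sets_subset_lebesgue_on by blast
  have le_N: "ennreal \<bar>LINT x:B|lebesgue. w x\<bar> \<le> emeasure N B" if B: "B \<in> borel_sets \<Omega>" for B
  proof -
    have "B \<subseteq> \<Omega>" using sets.sets_into_space[OF B] by (simp add: space_restrict_space)
    then have "\<bar>LINT x:B|lebesgue. w x\<bar> = norm (LINT x|?M. indicator B x *\<^sub>R w x)"
      using set_integral_lebesgue_on[OF \<Omega>] by simp
    also have "ennreal \<dots> \<le> (\<integral>\<^sup>+x. norm (indicator B x *\<^sub>R w x) \<partial>?M)"
      by (intro integral_norm_bound_ennreal integrable_mult_indicator meas B w)
    also have "\<dots> = (\<integral>\<^sup>+x. ennreal \<bar>w x\<bar> * indicator B x \<partial>?M)"
      by (intro nn_integral_cong) (auto simp: indicator_def)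
    also have "\<dots> = emeasure N B"
      unfolding N_def using meas[OF B] by (subst emeasure_density) auto
    finally show ?thesis .
  qed
  have "variation \<Omega> (\<lambda>A. \<nu> A - (LINT x:A|lebesgue. w x)) \<Omega> \<le> variation \<Omega> \<nu> \<Omega> + emeasure N \<Omega>"
    unfolding variation_def[of \<Omega> "\<lambda>A. \<nu> A - (LINT x:A|lebesgue. w x)"]
  proof (rule SUP_least)
    fix P assume P: "P \<in> {P. finite P \<and> P \<subseteq> borel_sets \<Omega> \<and> disjoint P \<and> \<Union> P = \<Omega>}"
    have "(\<Sum>B\<in>P. ennreal \<bar>\<nu> B - (LINT x:B|lebesgue. w x)\<bar>) \<le> (\<Sum>B\<in>P. ennreal \<bar>\<nu> B\<bar> + emeasure N B)"
    proof (rule sum_mono)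
      fix B assume "B \<in> P"
      then have "B \<in> borel_sets \<Omega>" using P by auto
      have "ennreal \<bar>\<nu> B - (LINT x:B|lebesgue. w x)\<bar> \<le> ennreal (\<bar>\<nu> B\<bar> + \<bar>LINT x:B|lebesgue. w x\<bar>)"
        by (intro ennreal_leI) linarith
      also have "\<dots> \<le> ennreal \<bar>\<nu> B\<bar> + emeasure N B"
        using le_N[OF \<open>B \<in> borel_sets \<Omega>\<close>] by (simp add: ennreal_plus add_left_mono del: ennreal_plus[symmetric])
      finally show "ennreal \<bar>\<nu> B - (LINT x:B|lebesgue. w x)\<bar> \<le> ennreal \<bar>\<nu> B\<bar> + emeasure N B" .
    qed
    also have "\<dots> = (\<Sum>B\<in>P. ennreal \<bar>\<nu> B\<bar>) + (\<Sum>B\<in>P. emeasure N B)"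
      by (rule sum.distrib)
    also have "(\<Sum>B\<in>P. emeasure N B) = emeasure N (\<Union>B\<in>P. B)"
    proof (rule sum_emeasure)
      show "(\<lambda>B. B) ` P \<subseteq> sets N" using P meas by (auto simp: N_def)
      show "disjoint_family_on (\<lambda>B. B) P"
        using P by (auto simp: disjoint_family_on_def disjoint_def)
    qed (use P in auto)
    also have "(\<Union>B\<in>P. B) = \<Omega>" using P by auto
    also have "(\<Sum>B\<in>P. ennreal \<bar>\<nu> B\<bar>) \<le> variation \<Omega> \<nu> \<Omega>"
      unfolding variation_def using P by (rule SUP_upper)
    finally show "(\<Sum>B\<in>P. ennreal \<bar>\<nu> B - (LINT x:B|lebesgue. w x)\<bar>) \<le> variation \<Omega> \<nu> \<Omega> + emeasure N \<Omega>"
      by (simp add: add_right_mono)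
  qed
  moreover have "emeasure N \<Omega> < \<infinity>"
  proof -
    have "emeasure N \<Omega> = (\<integral>\<^sup>+x. ennreal (norm (w x)) * indicator \<Omega> x \<partial>?M)"
      unfolding N_def by (subst emeasure_density) auto
    also have "\<dots> = (\<integral>\<^sup>+x. ennreal (norm (w x)) \<partial>?M)"
      by (intro nn_integral_cong) (auto simp: indicator_def)
    also have "\<dots> < \<infinity>" using w by (simp add: integrable_iff_bounded)
    finally show ?thesis .
  qed
  ultimately show ?thesis
    using \<nu> by (metis ennreal_add_eq_top infinity_ennreal_def order.strict_trans1 top.not_eq_extremum)
qed

text \<open>Integrals against Du and Du - w are defined through two different variation measures,
  each with its own sign function, so the identity of set functions Du = (Du - w) + w has to be
  carried over to integrals by a monotone class argument. Measurability enters through inclusions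
  because the third measure, Lebesgue measure, has more measurable sets than
  \<open>R\<close>.\<close>

lemma bounded_integral_eqI:
  fixes s1 s2 s3 \<eta> :: "'a \<Rightarrow> real"
  assumes meas: "borel_measurable R \<subseteq> (borel_measurable N1 :: ('a \<Rightarrow> real) set)"
      "borel_measurable R \<subseteq> (borel_measurable N2 :: ('a \<Rightarrow> real) set)" "borel_measurable R \<subseteq> (borel_measurable N3 :: ('a \<Rightarrow> real) set)"
    and space: "space N1 = space R" "space N2 = space R" "space N3 = space R"
    and int: "integrable N1 s1" "integrable N2 s2" "integrable N3 s3"
    and sets: "\<And>A. A \<in> sets R \<Longrightarrow> (LINT x|N1. indicator A x * s1 x)
      = (LINT x|N2. indicator A x * s2 x) + (LINT x|N3. indicator A x * s3 x)"
    and \<eta>: "\<eta> \<in> borel_measurable R" "\<And>x. x \<in> space R \<Longrightarrow> \<bar>\<eta> x\<bar> \<le> B"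
  shows "(LINT x|N1. \<eta> x * s1 x) = (LINT x|N2. \<eta> x * s2 x) + (LINT x|N3. \<eta> x * s3 x)"
proof -
  let ?P = "\<lambda>\<eta>. (LINT x|N1. \<eta> x * s1 x) = (LINT x|N2. \<eta> x * s2 x) + (LINT x|N3. \<eta> x * s3 x)"
  have integrable: "integrable N (\<lambda>x. \<xi> x * s x)"
    if "integrable N s" "\<xi> \<in> borel_measurable N" "\<And>x. x \<in> space N \<Longrightarrow> \<bar>\<xi> x\<bar> \<le> K"
    for N and s \<xi> :: "'a \<Rightarrow> real" and K
  proof (rule Bochner_Integration.integrable_bound)
    show "integrable N (\<lambda>x. K * s x)" using that(1) by simp
    show "(\<lambda>x. \<xi> x * s x) \<in> borel_measurable N" using that by measurable
    show "AE x in N. norm (\<xi> x * s x) \<le> norm (K * s x)"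
    proof (rule AE_I2)
      fix x assume "x \<in> space N"
      then have "\<bar>\<xi> x\<bar> \<le> \<bar>K\<bar>" using that(3)[of x] by linarith
      then show "norm (\<xi> x * s x) \<le> norm (K * s x)" by (simp add: abs_mult mult_right_mono)
    qed
  qed
  have ints: "integrable N1 (\<lambda>x. \<xi> x * s1 x)" "integrable N2 (\<lambda>x. \<xi> x * s2 x)" "integrable N3 (\<lambda>x. \<xi> x * s3 x)"
    if "\<xi> \<in> borel_measurable R" "\<And>x. x \<in> space R \<Longrightarrow> \<bar>\<xi> x\<bar> \<le> K" for \<xi> K
    by (rule integrable[OF int(1) subsetD[OF meas(1) that(1)], of K], simp add: space that(2),
        rule integrable[OF int(2) subsetD[OF meas(2) that(1)], of K], simp add: space that(2),
        rule integrable[OF int(3) subsetD[OF meas(3) that(1)], of K], simp add: space that(2))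
  \<comment> \<open>The bound is part of the claim and \<open>K\<close> is arbitrary: scaling by c
    turns it into K / c, and the limit step needs it for dominated convergence, the integrands being
    signed.\<close>
  have nonneg: "(\<forall>x\<in>space R. \<xi> x \<le> K) \<longrightarrow> ?P \<xi>"
    if "\<xi> \<in> borel_measurable R" "\<And>x. 0 \<le> \<xi> x" for \<xi> K
    using that
  proof (induction arbitrary: K rule: borel_measurable_induct_real)
    case (set A)
    then show ?case using sets by simp
  next
    case (mult \<xi> c)
    show ?case
    proof (cases "c = 0")
      case False
      show ?thesis
      proof
        assume "\<forall>x\<in>space R. c * \<xi> x \<le> K"
        then have "\<forall>x\<in>space R. \<xi> x \<le> K / c"
          using False \<open>0 \<le> c\<close> by (simp add: field_simps)
        with mult.IH have "?P \<xi>" by blast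
        then have "c * (LINT x|N1. \<xi> x * s1 x) = c * (LINT x|N2. \<xi> x * s2 x) + c * (LINT x|N3. \<xi> x * s3 x)"
          by (simp add: distrib_left)
        then show "?P (\<lambda>x. c * \<xi> x)" by (simp add: mult.assoc)
      qed
    qed simp
  next
    case (add \<xi> \<zeta>)
    show ?case
    proof
      assume *: "\<forall>x\<in>space R. \<zeta> x + \<xi> x \<le> K"
      have \<xi>: "0 \<le> \<xi> x \<and> \<xi> x \<le> K" and \<zeta>: "0 \<le> \<zeta> x \<and> \<zeta> x \<le> K" if "x \<in> space R" for x
        using * that add.hyps(2)[of x] add.hyps(4)[of x] by (force, force)
      have "?P \<xi>" "?P \<zeta>" using add.IH \<xi> \<zeta> by blast+
      then show "?P (\<lambda>x. \<zeta> x + \<xi> x)"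
        using ints[OF add.hyps(1), of K] ints[OF add.hyps(3), of K] \<xi> \<zeta> by (simp add: distrib_right)
    qed
  next
    case (seq U)
    show ?case
    proof
      assume *: "\<forall>x\<in>space R. \<xi> x \<le> K"
      have le: "U i x \<le> \<xi> x" if "x \<in> space R" for i x
        using seq.hyps(3) seq.hyps(4)[OF that]
        by (intro incseq_le[of "\<lambda>i. U i x"]) (auto simp: incseq_def le_fun_def)
      have bound: "\<bar>U i x\<bar> \<le> K" if "x \<in> space R" for i x
        using le[OF that, of i] * that seq.hyps(2)[of i x] by force
      have \<xi>: "\<xi> \<in> borel_measurable R"
        by (rule borel_measurable_LIMSEQ_real[OF seq.hyps(4) seq.hyps(1)])
      have P: "?P (U i)" for i using seq.IH[of i K] bound by (meson abs_le_D1)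
      have lim: "(\<lambda>i. LINT x|N. U i x * s x) \<longlonglongrightarrow> (LINT x|N. \<xi> x * s x)"
        if N: "borel_measurable R \<subseteq> (borel_measurable N :: ('a \<Rightarrow> real) set)" "space N = space R" and s: "integrable N s" for N and s :: "'a \<Rightarrow> real"
      proof (rule integral_dominated_convergence)
        show "integrable N (\<lambda>x. K * \<bar>s x\<bar>)" using s by simp
        show "(\<lambda>x. \<xi> x * s x) \<in> borel_measurable N"
          by (rule borel_measurable_times[OF subsetD[OF N(1) \<xi>] borel_measurable_integrable[OF s]])
        show "(\<lambda>x. U i x * s x) \<in> borel_measurable N" for i
          by (rule borel_measurable_times[OF subsetD[OF N(1) seq.hyps(1)] borel_measurable_integrable[OF s]])
        show "AE x in N. (\<lambda>i. U i x * s x) \<longlonglongrightarrow> \<xi> x * s x"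
          using seq.hyps(4) N(2) by (intro AE_I2 tendsto_intros) auto
        show "AE x in N. norm (U i x * s x) \<le> K * \<bar>s x\<bar>" for i
          using bound N(2) by (intro AE_I2) (auto simp: abs_mult mult_right_mono)
      qed
      have "(\<lambda>i. LINT x|N1. U i x * s1 x) \<longlonglongrightarrow> (LINT x|N2. \<xi> x * s2 x) + (LINT x|N3. \<xi> x * s3 x)"
        unfolding P by (intro tendsto_add lim meas space int)
      then show "?P \<xi>"
        using lim[OF meas(1) space(1) int(1)] LIMSEQ_unique by blast
    qed
  qed
  \<comment> \<open>Adding \<open>B\<close> reduces to the nonnegative case; \<open>max 0\<close>
    acts only off \<open>space R\<close>, since the induction asks for nonnegativity everywhere. The
    added constant is removed by the hypothesis on sets, taken for the whole space.\<close>
  define \<zeta> where "\<zeta> x = max 0 (\<eta> x + B)" for x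
  have "\<zeta> \<in> borel_measurable R" unfolding \<zeta>_def[abs_def] using \<eta>(1) by measurable
  moreover have \<zeta>_eq: "\<zeta> x = \<eta> x + B" if "x \<in> space R" for x
    using \<eta>(2)[OF that] by (simp add: \<zeta>_def)
  moreover have "\<forall>x\<in>space R. \<zeta> x \<le> 2 * B"
    using \<eta>(2) \<zeta>_eq by force
  ultimately have "?P \<zeta>" using nonneg[of \<zeta> "2 * B"] by (simp add: \<zeta>_def)
  moreover have eq: "(LINT x|N. \<zeta> x * s x) = (LINT x|N. \<eta> x * s x) + B * (LINT x|N. indicator (space R) x * s x)"
    if "space N = space R" "integrable N (\<lambda>x. \<eta> x * s x)" "integrable N s" for N and s :: "'a \<Rightarrow> real"
  proof -
    have "(LINT x|N. \<zeta> x * s x) = (LINT x|N. \<eta> x * s x + B * s x)"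
      using \<zeta>_eq that(1) by (intro Bochner_Integration.integral_cong) (auto simp: distrib_right)
    also have "\<dots> = (LINT x|N. \<eta> x * s x) + B * (LINT x|N. s x)"
      using that by simp
    also have "(LINT x|N. s x) = (LINT x|N. indicator (space R) x * s x)"
      using that(1) by (intro Bochner_Integration.integral_cong) auto
    finally show ?thesis .
  qed
  ultimately show ?thesis
    using eq[OF space(1) ints(1)[OF \<eta>] int(1)] eq[OF space(2) ints(2)[OF \<eta>] int(2)]
      eq[OF space(3) ints(3)[OF \<eta>] int(3)] sets[OF sets.top]
    by (simp add: distrib_left)
qed

subsection \<open>Uniqueness for the optimality system\<close>

lemma continuous_on_Icc_tendsto_at_left:
  fixes \<phi> :: "real \<Rightarrow> real"
  assumes "continuous_on {a..b} \<phi>" "a < x" "x \<le> b"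
  shows "(\<phi> \<longlongrightarrow> \<phi> x) (at_left x)"
proof -
  have "{a..x} \<subseteq> {a..b}" using assms by simp
  then show ?thesis
    using continuous_on_Icc_at_leftD[OF continuous_on_subset[OF assms(1)] \<open>a < x\<close>] by simp
qed

text \<open>For the candidate, the inclusion in \<alpha> times \<open>Sgn\<close> is replaced by the
  bound \<open>\<psi>_le\<close> and the alternative in \<open>J\<close>, so the variation of the
  explicit measure J \<delta>_0 is never computed. The assumption \<open>v_deriv\<close> is the
  equation Dv = \<psi>/\<beta> + J \<delta>_0 in weak form.\<close>

lemma optimality_system_unique:
  assumes L: "L > 0" and \<alpha>: "\<alpha> > 0" and \<beta>: "\<beta> > 0" and f: "f \<in> L2 {-L<..<L}"
    and u: "u \<in> BV {-L<..<L}" and w: "w \<in> L2 {-L<..<L}"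
    and assoc: "associated_function L f \<alpha> \<beta> w u \<phi>"
    and v: "v \<in> L2 {-L<..<L}" and \<psi>_cont: "continuous_on {-L..L} \<psi>"
    and \<psi>_approx: "H1_approximable {-L<..<L} \<psi> g"
    and g: "AE x in lebesgue_on {-L<..<L}. g x = v x - f x"
    and \<psi>_le: "\<And>x. x \<in> {-L<..<L} \<Longrightarrow> \<bar>\<psi> x\<bar> \<le> \<alpha>"
    and J: "J \<ge> 0" "J = 0 \<or> \<psi> 0 = \<alpha>"
    and v_deriv: "\<And>\<eta>. \<eta> \<in> test_functions {-L<..<L} \<Longrightarrow>
      (LINT x|lebesgue_on {-L<..<L}. v x * deriv \<eta> x)
        = - (LINT x|lebesgue_on {-L<..<L}. \<eta> x * (\<psi> x / \<beta>)) - J * \<eta> 0"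
  shows "AE x in lebesgue_on {-L<..<L}. u x = v x" and "\<And>x. x \<in> {-L<..<L} \<Longrightarrow> \<phi> x = \<psi> x"
    and "\<phi> (-L) = \<psi> (-L)"
proof -
  let ?\<Omega> = "{-L<..<L}"
  let ?\<Lambda> = "lebesgue_on ?\<Omega>"
  let ?R = "restrict_space borel ?\<Omega> :: real measure"
  have \<Omega>: "?\<Omega> \<in> sets borel" by simp
  have \<phi>_H: "\<phi> \<in> H1_0 ?\<Omega>" and \<phi>_cont: "continuous_on {-L..L} \<phi>"
    and \<phi>_weak: "has_weak_derivative ?\<Omega> \<phi> (\<lambda>x. u x - f x)"
    and \<phi>_w: "AE x in ?\<Lambda>. \<phi> x = \<beta> * w x"
    using assoc by (auto simp: associated_function_def)
  obtain s where s: "s \<in> Sgn ?\<Omega> (D_minus ?\<Omega> u w)" and \<phi>_s: "\<phi> = (\<lambda>x. \<alpha> * s x)"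
    using assoc by (auto simp: associated_function_def)
  have \<phi>_approx: "H1_approximable ?\<Omega> \<phi> (\<lambda>x. u x - f x)"
    by (rule H1_0_approximable[OF L \<phi>_H \<phi>_cont \<phi>_weak])
  have uf: "(\<lambda>x. u x - f x) \<in> L2 ?\<Omega>" using \<phi>_weak by (simp add: has_weak_derivative_def)
  have u_L2: "u \<in> L2 ?\<Omega>" using L2_add[OF uf f] by simp
  have g_L2: "g \<in> L2 ?\<Omega>" using \<psi>_approx by (simp add: H1_approximable_def)
  have \<phi>_L2: "\<phi> \<in> L2 ?\<Omega>" and \<psi>_L2: "\<psi> \<in> L2 ?\<Omega>"
    by (auto intro: L2_continuous \<phi>_cont \<psi>_cont)

  define \<nu> where "\<nu> = distr_derivative ?\<Omega> u"
  have "is_distr_derivative ?\<Omega> u \<nu>"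
    using u someI_ex[of "is_distr_derivative ?\<Omega> u"]
    unfolding \<nu>_def distr_derivative_def BV_def by blast
  then obtain \<sigma>\<nu> where \<nu>: "variation ?\<Omega> \<nu> ?\<Omega> < \<infinity>" and \<sigma>\<nu>: "polar_decomposition ?\<Omega> \<nu> \<sigma>\<nu>"
    and u_deriv: "\<And>\<eta>. \<eta> \<in> test_functions ?\<Omega> \<Longrightarrow>
      (LINT x|?\<Lambda>. u x * deriv \<eta> x) = - (LINT x|variation_measure ?\<Omega> \<nu>. \<eta> x * \<sigma>\<nu> x)"
    by (auto simp: is_distr_derivative_def finite_radon_measure_def)
  define N where "N = variation_measure ?\<Omega> \<nu>"
  define \<mu> where "\<mu> = D_minus ?\<Omega> u w"
  define M where "M = variation_measure ?\<Omega> \<mu>"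
  have \<mu>_eq: "\<mu> = (\<lambda>A. \<nu> A - (LINT x:A|lebesgue. w x))"
    by (auto simp: \<mu>_def D_minus_def \<nu>_def)
  have spaceN: "space N = ?\<Omega>" and setsN: "sets N = sets ?R"
    and spaceM: "space M = ?\<Omega>" and setsM: "sets M = sets ?R"
    unfolding M_def N_def by (rule space_variation_measure[OF \<Omega>] sets_variation_measure[OF \<Omega>])+
  have finN: "finite_measure N"
    unfolding N_def by (rule finite_measure_variation_measure[OF \<Omega> \<nu>])
  have finM: "finite_measure M"
    unfolding M_def \<mu>_eq
    by (intro finite_measure_variation_measure[OF \<Omega>] variation_minus_density_finite[OF \<Omega> \<nu>] L2_integrable w)
  obtain \<sigma> where \<sigma>: "polar_decomposition ?\<Omega> \<mu> \<sigma>" and s_\<sigma>: "AE x in M. s x = \<sigma> x"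
    and s_le: "AE x in ?\<Lambda>. \<bar>s x\<bar> \<le> 1"
    using s unfolding Sgn_def \<mu>_def[symmetric] M_def[symmetric] by blast
  have \<sigma>\<nu>_abs: "\<bar>\<sigma>\<nu> x\<bar> = 1" and \<sigma>_abs: "\<bar>\<sigma> x\<bar> = 1" if "x \<in> ?\<Omega>" for x
    using \<sigma>\<nu> \<sigma> that by (auto simp: polar_decomposition_def)
  have \<sigma>\<nu>_int: "integrable N \<sigma>\<nu>"
    using \<sigma>\<nu> \<sigma>\<nu>_abs spaceN
    by (intro finite_measure.integrable_const_bound[OF finN, of _ 1] AE_I2)
      (auto simp: polar_decomposition_def N_def)
  have \<sigma>_int: "integrable M \<sigma>"
    using \<sigma> \<sigma>_abs spaceM
    by (intro finite_measure.integrable_const_bound[OF finM, of _ 1] AE_I2)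
      (auto simp: polar_decomposition_def M_def)

  have borel_N: "borel_measurable ?R = (borel_measurable N :: (real \<Rightarrow> real) set)"
    and borel_M: "borel_measurable ?R = (borel_measurable M :: (real \<Rightarrow> real) set)"
    using setsN setsM by (auto cong: measurable_cong_sets)
  have cont_R: "\<xi> \<in> borel_measurable ?R" if "continuous_on ?\<Omega> \<xi>" for \<xi> :: "real \<Rightarrow> real"
    using that by (rule borel_measurable_continuous_on_restrict)
  have \<phi>_R: "\<phi> \<in> borel_measurable ?R" and \<psi>_R: "\<psi> \<in> borel_measurable ?R"
    by (auto intro!: cont_R intro: continuous_on_subset[OF \<phi>_cont] continuous_on_subset[OF \<psi>_cont])
  \<comment> \<open>Splits a pairing with Du into one with \<mu>, where the sign condition on \<phi>
    lives, and one with w, where \<phi> = \<beta> w applies.\<close>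
  have pairing: "(LINT x|N. \<xi> x * \<sigma>\<nu> x) = (LINT x|M. \<xi> x * \<sigma> x) + (LINT x|?\<Lambda>. \<xi> x * w x)"
    if "\<xi> \<in> borel_measurable ?R" "\<And>x. x \<in> ?\<Omega> \<Longrightarrow> \<bar>\<xi> x\<bar> \<le> B" for \<xi> B
  proof (rule bounded_integral_eqI[where R = ?R and B = B])
    show "borel_measurable ?R \<subseteq> (borel_measurable ?\<Lambda> :: (real \<Rightarrow> real) set)"
      using borel_measurable_lebesgue_on_restrict by blast
    show "(LINT x|N. indicator A x * \<sigma>\<nu> x) = (LINT x|M. indicator A x * \<sigma> x) + (LINT x|?\<Lambda>. indicator A x * w x)"
      if A: "A \<in> sets ?R" for A
    proof -
      have "A \<subseteq> ?\<Omega>" using sets.sets_into_space[OF A] by (simp add: space_restrict_space)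
      moreover have "\<nu> A = (LINT x|N. indicator A x * \<sigma>\<nu> x)" "\<mu> A = (LINT x|M. indicator A x * \<sigma> x)"
        using \<sigma>\<nu> \<sigma> A by (auto simp: polar_decomposition_def N_def M_def set_lebesgue_integral_def)
      ultimately show ?thesis
        using set_integral_lebesgue_on[OF \<Omega>, of A w] by (simp add: \<mu>_eq)
    qed
  qed (use that borel_N borel_M spaceN spaceM \<sigma>_int \<sigma>\<nu>_int L2_integrable[OF w] in
      \<open>auto simp: space_restrict_space\<close>)

  have u_formula: "(LINT x|?\<Lambda>. u x * d x) = - (LINT x|N. \<xi> x * \<sigma>\<nu> x)"
    if "H1_approximable ?\<Omega> \<xi> d" for \<xi> d
    using that u_L2 u_deriv[folded N_def]
  proof (rule H1_approximable_weak_formula)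
    fix \<eta> :: "nat \<Rightarrow> real \<Rightarrow> real"
    assume \<eta>: "\<And>n. \<eta> n \<in> test_functions ?\<Omega>" and lim: "uniform_limit ?\<Omega> \<eta> \<xi> sequentially"
    show "(\<lambda>n. - (LINT x|N. \<eta> n x * \<sigma>\<nu> x)) \<longlonglongrightarrow> - (LINT x|N. \<xi> x * \<sigma>\<nu> x)"
    proof (intro tendsto_minus uniform_limit_integral_mult(2) \<sigma>\<nu>_int)
      show "\<eta> n \<in> borel_measurable N" for n
        using cont_R[OF test_function_continuous[OF \<eta>]] borel_N by simp
      show "bounded (\<eta> n ` space N)" for n
        by (rule bounded_subset[OF test_function_bounded[OF \<eta>]]) auto
      show "uniform_limit (space N) \<eta> \<xi> sequentially" using lim spaceN by simp
    qed
  qed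
  have v_formula: "(LINT x|?\<Lambda>. v x * d x) = - (LINT x|?\<Lambda>. \<xi> x * (\<psi> x / \<beta>)) - J * \<xi> 0"
    if "H1_approximable ?\<Omega> \<xi> d" for \<xi> d
    using that v v_deriv
  proof (rule H1_approximable_weak_formula)
    fix \<eta> :: "nat \<Rightarrow> real \<Rightarrow> real"
    assume \<eta>: "\<And>n. \<eta> n \<in> test_functions ?\<Omega>" and lim: "uniform_limit ?\<Omega> \<eta> \<xi> sequentially"
    have "(\<lambda>n. LINT x|?\<Lambda>. \<eta> n x * (\<psi> x / \<beta>)) \<longlonglongrightarrow> (LINT x|?\<Lambda>. \<xi> x * (\<psi> x / \<beta>))"
    proof (rule uniform_limit_integral_mult(2))
      show "integrable ?\<Lambda> (\<lambda>x. \<psi> x / \<beta>)" using L2_integrable[OF \<psi>_L2] by simp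
      show "\<eta> n \<in> borel_measurable ?\<Lambda>" for n by (intro L2_measurable L2_test_function \<eta>)
      show "bounded (\<eta> n ` space ?\<Lambda>)" for n
        by (rule bounded_subset[OF test_function_bounded[OF \<eta>]]) auto
      show "uniform_limit (space ?\<Lambda>) \<eta> \<xi> sequentially" using lim by simp
    qed
    moreover have "(\<lambda>n. \<eta> n 0) \<longlonglongrightarrow> \<xi> 0"
      using L by (intro tendsto_uniform_limitI[OF lim]) simp
    ultimately show "(\<lambda>n. - (LINT x|?\<Lambda>. \<eta> n x * (\<psi> x / \<beta>)) - J * \<eta> n 0)
        \<longlonglongrightarrow> - (LINT x|?\<Lambda>. \<xi> x * (\<psi> x / \<beta>)) - J * \<xi> 0"
      by (intro tendsto_intros)
  qed

  have "bounded (\<phi> ` {-L..L})"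
    by (intro compact_imp_bounded compact_continuous_image \<phi>_cont compact_Icc)
  then obtain B where B: "\<forall>y\<in>\<phi> ` {-L..L}. norm y \<le> B" unfolding bounded_iff by blast
  have \<phi>B: "\<bar>\<phi> x\<bar> \<le> B" if "x \<in> ?\<Omega>" for x using B that by auto
  have w_eq: "(LINT x|?\<Lambda>. \<xi> x * w x) = (LINT x|?\<Lambda>. \<xi> x * \<phi> x) / \<beta>" if "\<xi> \<in> L2 ?\<Omega>" for \<xi>
  proof -
    have "(LINT x|?\<Lambda>. \<xi> x * w x) = (LINT x|?\<Lambda>. \<xi> x * \<phi> x / \<beta>)"
    proof (rule integral_cong_AE)
      show "AE x in ?\<Lambda>. \<xi> x * w x = \<xi> x * \<phi> x / \<beta>"
        using \<phi>_w by (rule AE_mp) (use \<beta> in auto)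
    qed (use L2_mult_integrable[OF that w] L2_mult_integrable[OF that \<phi>_L2] in auto)
    then show ?thesis by simp
  qed

  define a b c where "a = (LINT x|?\<Lambda>. \<phi> x * \<phi> x)" and "b = (LINT x|?\<Lambda>. \<psi> x * \<phi> x)"
    and "c = (LINT x|?\<Lambda>. \<psi> x * \<psi> x)"
  \<comment> \<open>The four products in the expansion of \<integral>(v - u)(\<psi>' - \<phi>'),
    which is the square integral of v - u because \<psi>' - \<phi>' = v - u a.e.\<close>
  have e1: "(LINT x|?\<Lambda>. u x * (u x - f x)) = - (LINT x|M. \<phi> x * \<sigma> x) - a / \<beta>"
    using u_formula[OF \<phi>_approx] pairing[OF \<phi>_R \<phi>B] w_eq[OF \<phi>_L2] by (simp add: a_def)
  have e2: "(LINT x|?\<Lambda>. u x * g x) = - (LINT x|M. \<psi> x * \<sigma> x) - b / \<beta>"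
    using u_formula[OF \<psi>_approx] pairing[OF \<psi>_R \<psi>_le] w_eq[OF \<psi>_L2] by (simp add: b_def)
  have e3: "(LINT x|?\<Lambda>. v x * (u x - f x)) = - b / \<beta> - J * \<phi> 0"
    using v_formula[OF \<phi>_approx] by (simp add: b_def mult.commute)
  have e4: "(LINT x|?\<Lambda>. v x * g x) = - c / \<beta> - J * \<psi> 0"
    using v_formula[OF \<psi>_approx] by (simp add: c_def)

  have M_le: "(LINT x|M. \<psi> x * \<sigma> x) \<le> (LINT x|M. \<phi> x * \<sigma> x)"
  proof (rule integral_mono_AE)
    have bounded_int: "integrable M (\<lambda>x. \<xi> x * \<sigma> x)"
      if "\<xi> \<in> borel_measurable ?R" "\<And>x. x \<in> ?\<Omega> \<Longrightarrow> \<bar>\<xi> x\<bar> \<le> K" for \<xi> K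
    proof (rule finite_measure.integrable_const_bound[OF finM, of _ K])
      show "AE x in M. norm (\<xi> x * \<sigma> x) \<le> K"
        using that(2) \<sigma>_abs spaceM by (intro AE_I2) (simp add: abs_mult)
      show "(\<lambda>x. \<xi> x * \<sigma> x) \<in> borel_measurable M"
        using that(1) borel_M \<sigma>_int by (intro borel_measurable_times) auto
    qed
    show "integrable M (\<lambda>x. \<psi> x * \<sigma> x)" by (rule bounded_int[OF \<psi>_R \<psi>_le])
    show "integrable M (\<lambda>x. \<phi> x * \<sigma> x)" by (rule bounded_int[OF \<phi>_R \<phi>B])
    show "AE x in M. \<psi> x * \<sigma> x \<le> \<phi> x * \<sigma> x"
      using s_\<sigma>
    proof (rule AE_mp, intro AE_I2 impI)
      fix x assume x: "x \<in> space M" "s x = \<sigma> x"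
      then have "\<bar>\<sigma> x\<bar> = 1" "\<bar>\<psi> x\<bar> \<le> \<alpha>" using \<sigma>_abs \<psi>_le spaceM by auto
      then show "\<psi> x * \<sigma> x \<le> \<phi> x * \<sigma> x"
        using x(2) by (auto simp: \<phi>_s abs_if split: if_splits)
    qed
  qed
  \<comment> \<open>The bound contained in \<open>Sgn\<close> holds only a.e., and the single point
    0 may be missed by it; continuity of \<phi> transfers it to 0, where the atom of Dv
    sits.\<close>
  have "\<phi> 0 \<le> \<alpha>"
  proof (rule ccontr)
    assume "\<not> \<phi> 0 \<le> \<alpha>"
    moreover have "(\<phi> \<longlongrightarrow> \<phi> 0) (at_left 0)"
      using L by (intro continuous_on_Icc_tendsto_at_left[OF \<phi>_cont]) auto
    moreover have neg: "- L < 0" using L by simp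
    ultimately have "\<forall>\<^sub>F x in at_left 0. \<alpha> < \<phi> x"
      by (intro order_tendstoD(1)) auto
    then obtain d where d: "d < 0" "\<And>x. d < x \<Longrightarrow> x < 0 \<Longrightarrow> \<alpha> < \<phi> x"
      unfolding eventually_at_left[OF neg] by auto
    obtain x where "x \<in> {max (-L) d<..<0}" "\<bar>s x\<bar> \<le> 1"
      using AE_lebesgue_on_imp_ex[OF s_le, of "max (-L) d" 0] L d(1) by auto
    then show False using d(2)[of x] \<alpha> mult_left_mono[of "s x" 1 \<alpha>] by (auto simp: \<phi>_s)
  qed
  then have J_le: "J * \<phi> 0 \<le> J * \<psi> 0" using J by (auto intro: mult_left_mono)

  have U: "(\<lambda>x. v x - u x) \<in> L2 ?\<Omega>" by (rule L2_diff[OF v u_L2])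
  have P: "(\<lambda>x. \<psi> x - \<phi> x) \<in> L2 ?\<Omega>" by (rule L2_diff[OF \<psi>_L2 \<phi>_L2])
  have int_U: "(LINT x|?\<Lambda>. (v x - u x)\<^sup>2) = (LINT x|?\<Lambda>. v x * g x) - (LINT x|?\<Lambda>. v x * (u x - f x))
      - (LINT x|?\<Lambda>. u x * g x) + (LINT x|?\<Lambda>. u x * (u x - f x))"
  proof -
    have "(LINT x|?\<Lambda>. (v x - u x)\<^sup>2)
        = (LINT x|?\<Lambda>. v x * g x - v x * (u x - f x) - u x * g x + u x * (u x - f x))"
    proof (rule integral_cong_AE)
      show "AE x in ?\<Lambda>. (v x - u x)\<^sup>2 = v x * g x - v x * (u x - f x) - u x * g x + u x * (u x - f x)"
        using g
      proof (rule AE_mp, intro AE_I2 impI)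
        fix x assume gx: "g x = v x - f x"
        show "(v x - u x)\<^sup>2 = v x * g x - v x * (u x - f x) - u x * g x + u x * (u x - f x)"
          unfolding gx by (simp add: power2_eq_square algebra_simps)
      qed
      show "(\<lambda>x. (v x - u x)\<^sup>2) \<in> borel_measurable ?\<Lambda>"
        using L2_measurable[OF U] by measurable
      show "(\<lambda>x. v x * g x - v x * (u x - f x) - u x * g x + u x * (u x - f x)) \<in> borel_measurable ?\<Lambda>"
        using L2_measurable[OF v] L2_measurable[OF g_L2] L2_measurable[OF u_L2] L2_measurable[OF f] by measurable
    qed
    then show ?thesis
      by (simp add: L2_mult_integrable v g_L2 u_L2 uf)
  qed
  have int_P: "(LINT x|?\<Lambda>. (\<psi> x - \<phi> x)\<^sup>2) = c - 2 * b + a"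
  proof -
    have "(LINT x|?\<Lambda>. (\<psi> x - \<phi> x)\<^sup>2) = (LINT x|?\<Lambda>. \<psi> x * \<psi> x - 2 * (\<psi> x * \<phi> x) + \<phi> x * \<phi> x)"
      by (intro Bochner_Integration.integral_cong) (auto simp: power2_eq_square algebra_simps)
    then show ?thesis
      by (simp add: L2_mult_integrable \<psi>_L2 \<phi>_L2 a_def b_def c_def)
  qed
  have sum_le: "(LINT x|?\<Lambda>. (v x - u x)\<^sup>2) + (LINT x|?\<Lambda>. (\<psi> x - \<phi> x)\<^sup>2) / \<beta> \<le> 0"
    using M_le J_le unfolding int_U int_P e1 e2 e3 e4 by (simp add: add_divide_distrib diff_divide_distrib)
  have nonneg: "(LINT x|?\<Lambda>. (v x - u x)\<^sup>2) \<ge> 0" "(LINT x|?\<Lambda>. (\<psi> x - \<phi> x)\<^sup>2) / \<beta> \<ge> 0"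
    using \<beta> by auto
  have "(LINT x|?\<Lambda>. (v x - u x)\<^sup>2) = 0" using sum_le nonneg by linarith
  then have "AE x in ?\<Lambda>. (v x - u x)\<^sup>2 = 0"
    using L2_integrable_square[OF U] by (subst (asm) integral_nonneg_eq_0_iff_AE) auto
  then show "AE x in ?\<Lambda>. u x = v x" by (rule AE_mp) auto
  have "(LINT x|?\<Lambda>. (\<psi> x - \<phi> x)\<^sup>2) / \<beta> = 0" using sum_le nonneg by linarith
  then have "(LINT x|?\<Lambda>. (\<psi> x - \<phi> x)\<^sup>2) = 0" using \<beta> by simp
  then have "AE x in ?\<Lambda>. (\<psi> x - \<phi> x)\<^sup>2 = 0"
    using L2_integrable_square[OF P] by (subst (asm) integral_nonneg_eq_0_iff_AE) auto
  then have AE_eq: "AE x in ?\<Lambda>. \<phi> x = \<psi> x" by (rule AE_mp) auto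
  show eq: "\<phi> x = \<psi> x" if "x \<in> ?\<Omega>" for x
    using that
    by (intro tendsto_at_left_AE_unique[OF AE_eq, of x]
        continuous_on_Icc_tendsto_at_left[OF \<phi>_cont] continuous_on_Icc_tendsto_at_left[OF \<psi>_cont]) auto
  show "\<phi> (-L) = \<psi> (-L)"
  proof (rule tendsto_unique)
    show "(\<psi> \<longlongrightarrow> \<psi> (-L)) (at_right (-L))"
      using L by (intro continuous_on_Icc_at_rightD[OF \<psi>_cont]) auto
    have "(\<phi> \<longlongrightarrow> \<phi> (-L)) (at_right (-L))"
      using L by (intro continuous_on_Icc_at_rightD[OF \<phi>_cont]) auto
    moreover have "\<forall>\<^sub>F x in at_right (-L). \<phi> x = \<psi> x"
      using eventually_at_right_real[of "-L" L] L by (auto elim!: eventually_mono intro: eq)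
    ultimately show "(\<psi> \<longlongrightarrow> \<phi> (-L)) (at_right (-L))"
      by (rule Lim_transform_eventually)
  qed simp
qed

subsection \<open>The two profiles\<close>

text \<open>Treats both profiles at once. With \<psi>(0) = (c1 - c2) / k and J = h - 2 (c1 + c2),
  the assumptions \<open>le\<close> and \<open>compl\<close> say that \<psi>(0) \<le> \<alpha>, that
  J \<ge> 0, and that one of the two is an equality.\<close>

lemma profile_of_admissible_coefficients:
  fixes L h \<alpha> \<beta> k c1 c2 :: real
  assumes L: "L > 0" and \<alpha>: "\<alpha> > 0" and \<beta>: "\<beta> > 0"
    and f: "f = (\<lambda>x. if x \<le> 0 then 0 else h)" and k: "k = 1 / sqrt \<beta>"
    and u: "u \<in> BV {-L<..<L}" and w: "w \<in> L2 {-L<..<L}"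
    and assoc: "associated_function L f \<alpha> \<beta> w u \<phi>"
    and c2: "c2 > 0" and c1: "c1 = c2 * exp (2 * k * L)"
    and le: "(c1 - c2) / k \<le> \<alpha>" "2 * (c1 + c2) \<le> h"
    and compl: "2 * (c1 + c2) = h \<or> (c1 - c2) / k = \<alpha>"
  shows "has_profile L h k u c1 c2" and "\<phi> 0 = (c1 - c2) / k" and "\<phi> (-L) = 0"
proof -
  let ?\<Omega> = "{-L<..<L}"
  have k0: "k > 0" and kk: "k * k = 1 / \<beta>"
    using \<beta> k by (auto simp: real_sqrt_mult_self)
  have c10: "c1 > 0" using c1 c2 by simp
  define q where "q t = c1 * exp (- k * t) + c2 * exp (k * t)" for t
  define q' where "q' t = k * (c2 * exp (k * t) - c1 * exp (- k * t))" for t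
  \<comment> \<open>A primitive of \<open>q\<close>; as q'' = k^2 q, also q' = k^2 F. The relation
    between c1 and c2 is exactly F(L) = 0, so \<psi> = - F \<bar>x\<bar>, which makes the density of
    Dv equal to \<psi>/\<beta> and \<psi> vanish at both ends.\<close>
  define F where "F t = (c2 * exp (k * t) - c1 * exp (- k * t)) / k" for t
  have F: "(F has_real_derivative q t) (at t)" for t
    unfolding F_def[abs_def] q_def using k0 by (auto intro!: derivative_eq_intros simp: field_simps)
  have q: "(q has_real_derivative q' t) (at t)" for t
    unfolding q_def[abs_def] q'_def by (auto intro!: derivative_eq_intros simp: algebra_simps)
  have q_cont: "continuous_on S q" for S
    unfolding q_def[abs_def] by (intro continuous_intros)
  have q'_cont: "continuous_on S q'" for S
    unfolding q'_def[abs_def] by (intro continuous_intros)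
  have FL: "F L = 0"
  proof -
    have "exp (2 * k * L) * exp (- k * L) = exp (k * L)" by (simp flip: exp_add)
    then show ?thesis unfolding F_def c1 by (simp add: mult.assoc)
  qed
  define v where "v x = (if x \<le> 0 then q \<bar>x\<bar> else h - q \<bar>x\<bar>)" for x
  define \<psi> where "\<psi> x = F L - F \<bar>x\<bar>" for x
  define J where "J = h - 2 * q 0"
  have q'_\<psi>: "q' \<bar>x\<bar> = - (\<psi> x / \<beta>)" for x
  proof -
    have "q' \<bar>x\<bar> = k * k * F \<bar>x\<bar>" using k0 by (simp add: q'_def F_def)
    then show ?thesis by (simp add: kk \<psi>_def FL)
  qed
  have \<psi>0: "\<psi> 0 = (c1 - c2) / k" 
  proof -
    have "F 0 = (c2 - c1) / k" by (simp add: F_def)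
    then show ?thesis by (simp add: \<psi>_def FL diff_divide_distrib)
  qed
  have F_abs: "continuous_on S (\<lambda>x. F \<bar>x\<bar>)" for S
    unfolding F_def using k0 by (intro continuous_intros) auto
  have fL2: "f \<in> L2 ?\<Omega>"
    using jump_function_L2[of "\<lambda>_. 0" h L] by (simp add: f cong: if_cong)
  \<comment> \<open>F increases because q is positive, so 0 \<le> \<psi> \<le> \<psi>(0): the
    constraint is tightest at 0.\<close>
  have \<psi>_bound: "\<bar>\<psi> x\<bar> \<le> \<alpha>" if x: "x \<in> ?\<Omega>" for x
  proof -
    have mono: "F s \<le> F t" if "s \<le> t" for s t
      using F c10 c2 that by (intro DERIV_nonneg_imp_nondecreasing[of s t F]) (auto simp: q_def intro!: exI add_nonneg_nonneg)
    have "F 0 \<le> F \<bar>x\<bar>" "F \<bar>x\<bar> \<le> F L" using mono x by auto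
    then show ?thesis using le(1) \<psi>0 by (simp add: \<psi>_def FL)
  qed
  have vL2: "v \<in> L2 ?\<Omega>" unfolding v_def[abs_def] by (rule jump_function_L2[OF q_cont])
  have \<psi>_cont: "continuous_on {-L..L} \<psi>"
    unfolding \<psi>_def[abs_def] by (intro continuous_on_diff continuous_on_const F_abs)
  have approx: "H1_approximable ?\<Omega> \<psi> (\<lambda>x. - (sgn x * q \<bar>x\<bar>))"
    unfolding \<psi>_def[abs_def] by (rule H1_approximable_even[OF L q_cont F])
  \<comment> \<open>At 0 the two sides differ, sgn 0 being 0 while v(0) = q(0) is positive.\<close>
  have AE_g: "AE x in lebesgue_on ?\<Omega>. - (sgn x * q \<bar>x\<bar>) = v x - f x"
  proof -
    have "AE x in lebesgue. x \<notin> {0::real}" by (intro AE_not_in) (simp flip: negligible_iff_null_sets)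
    then have "AE x in lebesgue_on ?\<Omega>. x \<noteq> 0" by (subst AE_restrict_space_iff) auto
    then show ?thesis by (rule AE_mp) (auto simp: v_def f)
  qed
  have J: "J \<ge> 0" "J = 0 \<or> \<psi> 0 = \<alpha>"
    using le(2) compl by (auto simp: J_def q_def \<psi>0)
  have v_deriv: "(LINT x|lebesgue_on ?\<Omega>. v x * deriv \<eta> x)
      = - (LINT x|lebesgue_on ?\<Omega>. \<eta> x * (\<psi> x / \<beta>)) - J * \<eta> 0" if "\<eta> \<in> test_functions ?\<Omega>" for \<eta>
    using jump_function_weak_derivative[OF L q q'_cont that, of h]
    by (simp add: v_def[abs_def] J_def q'_\<psi> mult.commute)
  note unique = optimality_system_unique[OF L \<alpha> \<beta> fL2 u w assoc vL2 \<psi>_cont approx AE_g \<psi>_bound J v_deriv]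
  have v_eq: "v = (\<lambda>x. if x \<le> 0 then c1 * exp (k * x) + c2 * exp (- k * x)
          else h - c1 * exp (- k * x) - c2 * exp (k * x))"
    by (auto simp: v_def q_def fun_eq_iff)
  show "has_profile L h k u c1 c2"
    using unique(1) unfolding has_profile_def representative_def v_eq .
  show "\<phi> 0 = (c1 - c2) / k" using unique(2)[of 0] L \<psi>0 by simp
  show "\<phi> (-L) = 0" using unique(3) L by (simp add: \<psi>_def)
qed

text \<open>Turns the a.e. description of u into the one-sided data at 0 and -L that define the
  types. The right limit exceeds v(0) by h - 2 (c1 + c2), so v is continuous once this
  vanishes.\<close>

lemma profile_left_data:
  fixes L h k c1 c2 :: real
  assumes L: "L > 0" and c1: "c1 = c2 * exp (2 * k * L)" and prof: "has_profile L h k u c1 c2"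
  defines "v \<equiv> (\<lambda>x. if x \<le> 0 then c1 * exp (k * x) + c2 * exp (- k * x)
          else h - c1 * exp (- k * x) - c2 * exp (k * x))"
  shows "left_data L u v" and "(v \<longlongrightarrow> h - (c1 + c2)) (at_right 0)"
    and "2 * (c1 + c2) = h \<Longrightarrow> continuous_on S v" and "v 0 = c1 + c2"
proof -
  define p where "p x = c1 * exp (k * x) + c2 * exp (- k * x)" for x
  define r where "r x = h - c1 * exp (- k * x) - c2 * exp (k * x)" for x
  have p_cont: "continuous_on S p" and r_cont: "continuous_on S r" for S
    unfolding p_def[abs_def] r_def[abs_def] by (intro continuous_intros)+
  show v0: "v 0 = c1 + c2" by (simp add: v_def)
  have "(p \<longlongrightarrow> p 0) (at_left 0)"
    using p_cont[of UNIV] by (meson UNIV_I continuous_on_def filterlim_at_split open_UNIV at_within_open tendsto_within_subset top_greatest)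
  then have "(p \<longlongrightarrow> v 0) (at_left 0)" by (simp add: v0 p_def)
  then have left: "(v \<longlongrightarrow> v 0) (at_left 0)"
    by (rule Lim_transform_eventually)
      (auto simp: v_def p_def eventually_at_filter intro!: always_eventually)
  have "(r \<longlongrightarrow> r 0) (at_right 0)"
    using r_cont[of UNIV] by (meson UNIV_I continuous_on_def filterlim_at_split open_UNIV at_within_open tendsto_within_subset top_greatest)
  then have "(v \<longlongrightarrow> r 0) (at_right 0)"
    by (rule Lim_transform_eventually)
      (auto simp: v_def r_def eventually_at_filter intro!: always_eventually)
  then show "(v \<longlongrightarrow> h - (c1 + c2)) (at_right 0)" by (simp add: r_def algebra_simps)
  \<comment> \<open>The derivative of \<open>p\<close> at -L is k (c1 exp (-k L) - c2 exp (k L)),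
    which is 0 by the relation between c1 and c2.\<close>
  have "exp (- (k * L)) * exp (2 * (k * L)) = exp (k * L)" by (simp flip: exp_add)
  then have "(p has_real_derivative 0) (at (-L))"
    unfolding p_def[abs_def] c1 by (auto intro!: derivative_eq_intros simp: mult.assoc)
  then have "(p has_real_derivative 0) (at (-L) within {-L..0})"
    by (rule has_field_derivative_at_within)
  then have "(v has_real_derivative 0) (at (-L) within {-L..0})"
    by (rule has_field_derivative_transform_within[of _ _ _ _ 1]) (use L in \<open>auto simp: v_def p_def\<close>)
  then show "left_data L u v"
    using left prof unfolding left_data_def has_profile_def v_def by blast
  show "continuous_on S v" if "2 * (c1 + c2) = h"
  proof -
    have "continuous_on ({x. x \<le> 0} \<union> {x. x \<ge> 0}) (\<lambda>x. if x \<le> 0 then p x else r x)"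
      using that
      by (intro continuous_on_If closed_Collect_le continuous_intros p_cont r_cont) (auto simp: p_def r_def)
    moreover have "{x. x \<le> 0} \<union> {x. x \<ge> (0::real)} = UNIV" by auto
    moreover have "v = (\<lambda>x. if x \<le> 0 then p x else r x)"
      unfolding v_def p_def r_def by (rule refl)
    ultimately have "continuous_on UNIV v" by simp
    then show ?thesis by (rule continuous_on_subset) simp
  qed
qed

section \<open>The dichotomy in terms of tanh (k L) / k and 2 \<alpha> / h\<close>

theorem mainTheorem7:
  fixes L h \<alpha> \<beta> k :: real and f w u \<phi> :: "real \<Rightarrow> real" and c2i c2ii :: real
  assumes "L > 0" "h > 0" "\<alpha> > 0" "\<beta> > 0"
    and f: "f = (\<lambda>x. if x \<le> 0 then 0 else h)"
    and k: "k = 1 / sqrt \<beta>"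
    and sol: "solution_pair {-L<..<L} f \<alpha> \<beta> w u"
    and w_nonzero: "\<not> (AE x in lebesgue_on {-L<..<L}. w x = 0)"
    and phi: "associated_function L f \<alpha> \<beta> w u \<phi>"
    and c2i: "c2i = h / (2 * (exp (2 * k * L) + 1))"
    and c2ii: "c2ii = \<alpha> * k / (exp (2 * k * L) - 1)"
  shows
    "(continuous_type L h \<alpha> u \<phi> \<and> has_profile L h k u (c2i * exp (2 * k * L)) c2i
        \<longleftrightarrow> tanh (k * L) / k < 2 * \<alpha> / h)
     \<and> (continuous_type L h \<alpha> u \<phi> \<longrightarrow> has_profile L h k u (c2i * exp (2 * k * L)) c2i)
     \<and> (jump_type L h \<alpha> u \<phi> \<and> has_profile L h k u (c2ii * exp (2 * k * L)) c2ii
        \<longleftrightarrow> tanh (k * L) / k > 2 * \<alpha> / h)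
     \<and> (jump_type L h \<alpha> u \<phi> \<longrightarrow> has_profile L h k u (c2ii * exp (2 * k * L)) c2ii)
     \<and> (tanh (k * L) / k \<noteq> 2 * \<alpha> / h \<longrightarrow>
          (continuous_type L h \<alpha> u \<phi> \<longleftrightarrow> \<not> jump_type L h \<alpha> u \<phi>))
     \<and> ((\<exists>v. representative L u v \<and> continuous_on {-L<..<L} v)
            \<and> has_profile L h k u (c2i * exp (2 * k * L)) c2i
        \<or> jump_type L h \<alpha> u \<phi> \<and> has_profile L h k u (c2ii * exp (2 * k * L)) c2ii)"
proof -
  define T E where "T = tanh (k * L) / k" and "E = exp (2 * k * L)"
  have k0: "k > 0" using \<open>\<beta> > 0\<close> k by simp
  have E1: "E > 1" using k0 \<open>L > 0\<close> by (simp add: E_def)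
  have T_eq: "T * k * (E + 1) = E - 1"
  proof -
    have "exp (- 2 * (k * L)) = 1 / E" by (simp add: E_def exp_minus field_simps)
    then have "tanh (k * L) = (1 - 1 / E) / (1 + 1 / E)" by (simp add: tanh_real_altdef)
    moreover have "1 - 1 / E = (E - 1) / E" "1 + 1 / E = (E + 1) / E"
      using E1 by (simp_all add: diff_divide_distrib add_divide_distrib)
    ultimately have "tanh (k * L) = (E - 1) / (E + 1)" using E1 by simp
    then show ?thesis using E1 k0 by (simp add: T_def)
  qed
  then have "T * (k * (E + 1)) = E - 1" by (simp only: mult.assoc)
  then have T: "T = (E - 1) / (k * (E + 1))" using E1 k0 by (simp add: eq_divide_eq)
  have T0: "T > 0" using E1 k0 by (simp add: T)
  have c2i_E: "c2i = h / (2 * (E + 1))" and c2ii_E: "c2ii = \<alpha> * k / (E - 1)"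
    unfolding c2i c2ii E_def by (rule refl)+
  \<comment> \<open>With c1 = E c2 these are the values of \<psi>(0) and of c1 + c2. For (i) only
    \<psi>(0) = h T / 2 \<le> \<alpha> remains to be required, for (ii) only 2 \<alpha> / T \<le> h,
    and both compare T with 2 \<alpha> / h.\<close>
  have "(c2i * (E - 1)) / k = h / 2 * T" "c2i * (E + 1) = h / 2"
      "(c2ii * (E - 1)) / k = \<alpha>" "c2ii * (E + 1) = \<alpha> / T"
  proof -
    define p m where "p = E + 1" and "m = E - 1"
    have "p \<noteq> 0" "m \<noteq> 0" using E1 by (auto simp: p_def m_def)
    then show "(c2i * (E - 1)) / k = h / 2 * T" "c2i * (E + 1) = h / 2"
        "(c2ii * (E - 1)) / k = \<alpha>" "c2ii * (E + 1) = \<alpha> / T"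
      unfolding c2i_E c2ii_E T p_def[symmetric] m_def[symmetric] using k0
      by (auto simp: field_simps)
  qed
  then have i_diff: "(c2i * E - c2i) / k = h / 2 * T" and i_sum: "2 * (c2i * E + c2i) = h"
    and ii_diff: "(c2ii * E - c2ii) / k = \<alpha>" and ii_sum: "c2ii * E + c2ii = \<alpha> / T"
    by (simp_all add: algebra_simps)
  have T_le: "T \<le> 2 * \<alpha> / h \<longleftrightarrow> h / 2 * T \<le> \<alpha>" and T_less: "T < 2 * \<alpha> / h \<longleftrightarrow> h / 2 * T < \<alpha>"
    using \<open>h > 0\<close> by (simp_all add: field_simps)
  have T_ge: "2 * \<alpha> / h \<le> T \<longleftrightarrow> 2 * (\<alpha> / T) \<le> h" and T_gr: "2 * \<alpha> / h < T \<longleftrightarrow> 2 * (\<alpha> / T) < h"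
    using \<open>h > 0\<close> T0 by (simp_all add: field_simps)
  have u: "u \<in> BV {-L<..<L}" and w: "w \<in> L2 {-L<..<L}"
    using sol by (auto simp: solution_pair_def)
  have c2i_pos: "c2i > 0" and c2ii_pos: "c2ii > 0"
    using E1 k0 \<open>h > 0\<close> \<open>\<alpha> > 0\<close> by (simp_all add: c2i_E c2ii_E)
  note profile = profile_of_admissible_coefficients[OF \<open>L > 0\<close> \<open>\<alpha> > 0\<close> \<open>\<beta> > 0\<close> f k u w phi _ refl,
      folded E_def]
  \<comment> \<open>After rewriting, the complementarity alternative reads h = h for (i) and
    \<alpha> = \<alpha> for (ii). The inequalities are not strict, so both facts are available when
    T = 2 \<alpha> / h.\<close>
  have i: "has_profile L h k u (c2i * E) c2i" "\<phi> 0 = h / 2 * T" "\<phi> (-L) = 0" if "T \<le> 2 * \<alpha> / h"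
    using profile[OF c2i_pos, unfolded i_diff i_sum] that unfolding T_le by blast+
  have ii: "has_profile L h k u (c2ii * E) c2ii" "\<phi> 0 = \<alpha>" "\<phi> (-L) = 0" if "2 * \<alpha> / h \<le> T"
    using profile[OF c2ii_pos, unfolded ii_diff ii_sum] that unfolding T_ge by blast+
  have E_i: "c2i * E = c2i * exp (2 * k * L)" and E_ii: "c2ii * E = c2ii * exp (2 * k * L)"
    by (simp_all add: E_def)
  have i_continuous: "\<exists>v. left_data L u v \<and> continuous_on {-L<..<L} v \<and> v 0 = h / 2" if T_le': "T \<le> 2 * \<alpha> / h"
  proof -
    obtain v where "left_data L u v" "continuous_on {-L<..<L} v" "v 0 = c2i * E + c2i"
      using profile_left_data[OF \<open>L > 0\<close> E_i i(1)[OF T_le']] i_sum by blast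
    moreover from this(3) have "v 0 = h / 2" using i_sum by simp
    ultimately show ?thesis by blast
  qed
  \<comment> \<open>Strictness comes from \<phi>(0) < \<alpha>: already at equality
    \<open>ii\<close> gives \<phi>(0) = \<alpha>.\<close>
  have continuous_iff: "continuous_type L h \<alpha> u \<phi> \<longleftrightarrow> T < 2 * \<alpha> / h"
  proof
    assume "continuous_type L h \<alpha> u \<phi>"
    then have "\<phi> 0 < \<alpha>" by (simp add: continuous_type_def)
    then show "T < 2 * \<alpha> / h" using ii(2) by force
  next
    assume "T < 2 * \<alpha> / h"
    then show "continuous_type L h \<alpha> u \<phi>"
      using i(2,3) i_continuous T_less by (simp add: continuous_type_def)
  qed
  have jump_iff: "jump_type L h \<alpha> u \<phi> \<longleftrightarrow> 2 * \<alpha> / h < T"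
  proof
    assume "jump_type L h \<alpha> u \<phi>"
    then obtain v where v: "left_data L u v" "v 0 < h / 2" by (auto simp: jump_type_def)
    show "2 * \<alpha> / h < T"
    proof (rule ccontr)
      assume "\<not> 2 * \<alpha> / h < T"
      then obtain v' where v': "left_data L u v'" "v' 0 = h / 2" using i_continuous by force
      \<comment> \<open>Here strictness comes from the value at 0: \<open>i_continuous\<close>
        provides a representative with value h/2, and left limits do not depend on the
        representative.\<close>
      have "AE x in lebesgue_on {-L<..<L}. u x = v x" "AE x in lebesgue_on {-L<..<L}. u x = v' x"
        using v v' by (auto simp: left_data_def representative_def)
      then have "AE x in lebesgue_on {-L<..<L}. v x = v' x" by eventually_elim simp
      then have "v 0 = v' 0"
        by (rule tendsto_at_left_AE_unique[where c = 0]) (use \<open>L > 0\<close> v v' in \<open>auto simp: left_data_def\<close>)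
      then show False using v v' by simp
    qed
  next
    assume T_gt: "2 * \<alpha> / h < T"
    then have T_ge': "2 * \<alpha> / h \<le> T" by simp
    have less: "c2ii * E + c2ii < h / 2" using T_gt unfolding T_gr ii_sum by linarith
    obtain v where v: "left_data L u v" "(v \<longlongrightarrow> h - (c2ii * E + c2ii)) (at_right 0)"
        and v0: "v 0 = c2ii * E + c2ii"
      using profile_left_data[OF \<open>L > 0\<close> E_ii ii(1)[OF T_ge']] by blast
    have "v 0 < h / 2" using less by (simp only: v0)
    moreover from this have "h - v 0 \<noteq> v 0" by linarith
    ultimately show "jump_type L h \<alpha> u \<phi>"
      using v[folded v0] ii(2,3)[OF T_ge'] unfolding jump_type_def by blast
  qed
  \<comment> \<open>Stated for T \<le> 2 \<alpha> / h, so that the final disjunction also covers the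
    borderline case, in which u is continuous without being of continuous type.\<close>
  have "\<exists>v. representative L u v \<and> continuous_on {-L<..<L} v" if "T \<le> 2 * \<alpha> / h"
    using i_continuous[OF that] by (auto simp: left_data_def)
  then show ?thesis
    using continuous_iff jump_iff i(1) ii(1)
    unfolding T_def[symmetric] E_def[symmetric] by force
qed

end
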